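(* Let $\rho$ be an unknown $n$-qubit state and let $O_1,\dots,O_M$ be $M$ $n$-qubit observables with $B_\infty=\max_i\|O_i\|_\infty$. Suppose each observable $O_i$ is a sum of few-body observables $O_i=\sum_j O_{ij}$, where every qubit is acted on by a constant number of the few-body observables $O_{ij}$. Then after $N$ randomized Pauli measurements on copies of $\rho$ with $$N=\mathcal{O}\left(\frac{\log\big(\min(M,n)\big)\,B_\infty^2}{\epsilon^2}\right),$$ we can estimate $\mathrm{tr}(O_i\rho)$ to $\epsilon$ error for all $i\in\{1,\dots,M\}$ with high probability.
   Context: $\|\cdot\|_\infty$ is the spectral norm. A few-body observable acts nontrivially on at most $k=\mathcal{O}(1)$ qubits, and for each fixed $i$ every qubit is acted on by at most $d=\mathcal{O}(1)$ of the $O_{ij}$; the constant hidden in $\mathcal{O}(\cdot)$ may depend on $k$ and $d$. A randomized Pauli measurement is performed on a single copy of $\rho$ and measures each qubit in a uniformly random Pauli basis ($X$, $Y$, or $Z$).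
   Formalization: The factor log(min(M,n)) is replaced by max(1, log(min(M,n))), since for min(M,n)=1 the literal bound would allow no measurements at all, which is false; for min(M,n) ≥ 2 this changes only the constant. *)

theory Defs
  imports "HOL-Probability.Probability" "Jordan_Normal_Form.Schur_Decomposition"
begin

unbundle no vec_syntax

text \<open>
  An operator on \<open>n\<close> qubits is a complex \<open>2^n \<times> 2^n\<close> matrix. The computational basis state with
  index \<open>r < 2^n\<close> has qubit \<open>q < n\<close> in state \<open>bit r q\<close>.
\<close>

definition mat_trace :: "complex mat \<Rightarrow> complex" where
  "mat_trace A = (\<Sum>i<dim_row A. A $$ (i, i))"

definition mat_sum :: "nat \<Rightarrow> nat \<Rightarrow> (nat \<Rightarrow> complex mat) \<Rightarrow> complex mat" where
  "mat_sum N J h = mat N N (\<lambda>(r, c). \<Sum>j<J. h j $$ (r, c))"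

definition l2_norm :: "complex vec \<Rightarrow> real" where
  "l2_norm v = L2_set (\<lambda>i. cmod (v $ i)) {..<dim_vec v}"

definition spectral_norm :: "complex mat \<Rightarrow> real" where
  "spectral_norm A = (SUP v \<in> {v \<in> carrier_vec (dim_col A). l2_norm v = 1}. l2_norm (A *\<^sub>v v))"

definition observable :: "nat \<Rightarrow> complex mat \<Rightarrow> bool" where
  "observable n A \<longleftrightarrow> A \<in> carrier_mat (2 ^ n) (2 ^ n) \<and> mat_adjoint A = A"

definition quantum_state :: "nat \<Rightarrow> complex mat \<Rightarrow> bool" where
  "quantum_state n \<rho> \<longleftrightarrow> \<rho> \<in> carrier_mat (2 ^ n) (2 ^ n) \<and> mat_adjoint \<rho> = \<rho> \<and>
     (\<forall>v \<in> carrier_vec (2 ^ n). 0 \<le> Re ((\<rho> *\<^sub>v v) \<bullet>c v)) \<and> mat_trace \<rho> = 1"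


text \<open>
  \<open>del_bit q r\<close> removes the binary digit at position \<open>q\<close> from \<open>r\<close>. An operator acts trivially on
  qubit \<open>q\<close> if it is the tensor product of the identity on qubit \<open>q\<close> with some operator on the
  remaining \<open>n - 1\<close> qubits.
\<close>

definition del_bit :: "nat \<Rightarrow> nat \<Rightarrow> nat" where
  "del_bit q r = r mod 2 ^ q + 2 ^ q * (r div 2 ^ Suc q)"

definition acts_trivially :: "nat \<Rightarrow> nat \<Rightarrow> complex mat \<Rightarrow> bool" where
  "acts_trivially n q A \<longleftrightarrow> (\<exists>A' \<in> carrier_mat (2 ^ (n - 1)) (2 ^ (n - 1)).
     A = mat (2 ^ n) (2 ^ n)
       (\<lambda>(r, c). of_bool (bit r q = bit c q) * A' $$ (del_bit q r, del_bit q c)))"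

definition qubit_support :: "nat \<Rightarrow> complex mat \<Rightarrow> nat set" where
  "qubit_support n A = {q. q < n \<and> \<not> acts_trivially n q A}"

definition sum_of_few_body :: "nat \<Rightarrow> nat \<Rightarrow> nat \<Rightarrow> complex mat \<Rightarrow> bool" where
  "sum_of_few_body n k d A \<longleftrightarrow> (\<exists>J h.
     (\<forall>j<J. observable n (h j) \<and> card (qubit_support n (h j)) \<le> k) \<and>
     (\<forall>q<n. card {j. j < J \<and> q \<in> qubit_support n (h j)} \<le> d) \<and>
     A = mat_sum (2 ^ n) J h)"


datatype pauli = PauliX | PauliY | PauliZ

fun pauli_mat :: "pauli \<Rightarrow> complex mat" where
  "pauli_mat PauliX = mat_of_rows_list 2 [[0, 1], [1, 0]]"
| "pauli_mat PauliY = mat_of_rows_list 2 [[0, - \<i>], [\<i>, 0]]"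
| "pauli_mat PauliZ = mat_of_rows_list 2 [[1, 0], [0, - 1]]"

text \<open>The outcome \<open>False\<close> stands for the eigenvalue \<open>1\<close> and \<open>True\<close> for the eigenvalue \<open>-1\<close>.\<close>

definition pauli_projector :: "pauli \<Rightarrow> bool \<Rightarrow> complex mat" where
  "pauli_projector P s = (1 / 2) \<cdot>\<^sub>m (1\<^sub>m 2 + (if s then - 1 else 1) \<cdot>\<^sub>m pauli_mat P)"

definition tensor :: "nat \<Rightarrow> (nat \<Rightarrow> complex mat) \<Rightarrow> complex mat" where
  "tensor n B =
     mat (2 ^ n) (2 ^ n) (\<lambda>(r, c). \<Prod>q<n. B q $$ (of_bool (bit r q), of_bool (bit c q)))"

text \<open>
  Measuring qubit \<open>q\<close> of \<open>\<rho>\<close> in the eigenbasis of \<open>b q\<close>, for all \<open>q < n\<close>: the outcome string has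
  the probability given by the Born rule.
\<close>

definition pauli_outcome :: "nat \<Rightarrow> complex mat \<Rightarrow> (nat \<Rightarrow> pauli) \<Rightarrow> (nat \<Rightarrow> bool) pmf" where
  "pauli_outcome n \<rho> b = embed_pmf (\<lambda>s. if \<forall>q\<ge>n. \<not> s q
     then Re (mat_trace (\<rho> * tensor n (\<lambda>q. pauli_projector (b q) (s q)))) else 0)"

definition randomized_pauli_measurement ::
    "nat \<Rightarrow> complex mat \<Rightarrow> ((nat \<Rightarrow> pauli) \<times> (nat \<Rightarrow> bool)) pmf" where
  "randomized_pauli_measurement n \<rho> =
     do {b \<leftarrow> Pi_pmf {..<n} undefined (\<lambda>_. pmf_of_set {PauliX, PauliY, PauliZ});
         s \<leftarrow> pauli_outcome n \<rho> b;
         return_pmf (b, s)}"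

definition randomized_pauli_measurements ::
    "nat \<Rightarrow> nat \<Rightarrow> complex mat \<Rightarrow> (nat \<Rightarrow> (nat \<Rightarrow> pauli) \<times> (nat \<Rightarrow> bool)) pmf" where
  "randomized_pauli_measurements N n \<rho> =
     Pi_pmf {..<N} undefined (\<lambda>_. randomized_pauli_measurement n \<rho>)"


text \<open>The Born probabilities form a distribution, so \<open>embed_pmf\<close> is used within its domain.\<close>

definition pauli_eigvec :: "pauli \<Rightarrow> bool \<Rightarrow> bool \<Rightarrow> complex" where
  "pauli_eigvec P s x = (case P of
     PauliX \<Rightarrow> (if s \<and> x then - 1 else 1) / sqrt 2
   | PauliY \<Rightarrow> (if x then (if s then - \<i> else \<i>) else 1) / sqrt 2
   | PauliZ \<Rightarrow> of_bool (x = s))"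

lemma pauli_projector_index:
  "pauli_projector P s $$ (of_bool x, of_bool y) = pauli_eigvec P s x * cnj (pauli_eigvec P s y)"
proof -
  have "complex_of_real (sqrt 2) * complex_of_real (sqrt 2) = 2"
    by (simp flip: of_real_mult)
  then show ?thesis
    by (cases P; cases s; cases x; cases y)
      (auto simp: pauli_projector_def pauli_eigvec_def mat_of_rows_list_def)
qed

lemma pauli_projector_complete:
  "(\<Sum>s\<in>UNIV. pauli_projector P s $$ (of_bool x, of_bool y)) = of_bool (x = y)"
  by (cases P; cases x; cases y)
    (auto simp: pauli_projector_def mat_of_rows_list_def UNIV_bool)

lemma nat_eq_if_bits_eq:
  fixes r c :: nat
  assumes "r < 2 ^ n" "c < 2 ^ n" "\<And>q. q < n \<Longrightarrow> bit r q = bit c q"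
  shows "r = c"
proof (rule bit_eqI)
  fix q
  show "bit r q = bit c q"
  proof (cases "q < n")
    case False
    then have "(2::nat) ^ n \<le> 2 ^ q" by (intro power_increasing) auto
    with assms(1,2) have "r < 2 ^ q" "c < 2 ^ q" by linarith+
    then have "r div 2 ^ q = 0" "c div 2 ^ q = 0" by (simp_all only: div_less)
    then show ?thesis by (simp add: bit_iff_odd)
  qed (use assms in auto)
qed

lemma tensor_projector_complete:
  assumes "r < 2 ^ n" "c < 2 ^ n"
  shows "(\<Sum>s | \<forall>q\<ge>n. \<not> s q. tensor n (\<lambda>q. pauli_projector (b q) (s q)) $$ (r, c)) =
    of_bool (r = c)"
proof -
  let ?f = "\<lambda>q s. pauli_projector (b q) s $$ (of_bool (bit r q), of_bool (bit c q))"
  have "(\<Sum>s | \<forall>q\<ge>n. \<not> s q. tensor n (\<lambda>q. pauli_projector (b q) (s q)) $$ (r, c)) =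
      (\<Sum>s | \<forall>q\<ge>n. \<not> s q. \<Prod>q<n. ?f q (s q))"
    using assms by (simp add: tensor_def)
  also have "\<dots> = (\<Sum>s \<in> PiE {..<n} (\<lambda>_. UNIV). \<Prod>q<n. ?f q (s q))"
    by (rule sum.reindex_bij_witness[where i = "\<lambda>s q. if q < n then s q else False"
          and j = "\<lambda>s. restrict s {..<n}"])
      (auto simp: PiE_def extensional_def restrict_def fun_eq_iff)
  also have "\<dots> = (\<Prod>q<n. \<Sum>s\<in>UNIV. ?f q s)"
    by (subst prod_sum_PiE) auto
  also have "\<dots> = (\<Prod>q<n. of_bool (bit r q = bit c q))"
    by (simp only: pauli_projector_complete)
  also have "\<dots> = of_bool (r = c)"
    using nat_eq_if_bits_eq[OF assms] by (auto simp: prod_zero_iff)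
  finally show ?thesis .
qed

lemma tensor_carrier: "tensor n B \<in> carrier_mat (2 ^ n) (2 ^ n)"
  by (simp add: tensor_def)

lemma mat_trace_mult:
  assumes "A \<in> carrier_mat N N" "B \<in> carrier_mat N N"
  shows "mat_trace (A * B) = (\<Sum>r<N. \<Sum>c<N. A $$ (r, c) * B $$ (c, r))"
  using assms by (simp add: mat_trace_def scalar_prod_def atLeast0LessThan)

lemma finite_outcomes: "finite {s :: nat \<Rightarrow> bool. \<forall>q\<ge>n. \<not> s q}"
proof (rule finite_subset)
  show "{s :: nat \<Rightarrow> bool. \<forall>q\<ge>n. \<not> s q} \<subseteq> (\<lambda>A q. q \<in> A) ` Pow {..<n}"
  proof
    fix s :: "nat \<Rightarrow> bool" assume s: "s \<in> {s. \<forall>q\<ge>n. \<not> s q}"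
    then show "s \<in> (\<lambda>A q. q \<in> A) ` Pow {..<n}"
      by (intro image_eqI[where x = "{q. s q}"]) (auto simp: not_less[symmetric])
  qed
qed simp

lemma pauli_outcome_prob_nonneg:
  assumes "quantum_state n \<rho>"
  shows "0 \<le> Re (mat_trace (\<rho> * tensor n (\<lambda>q. pauli_projector (b q) (s q))))"
proof -
  define u where "u r = (\<Prod>q<n. pauli_eigvec (b q) (s q) (bit r q))" for r :: nat
  have \<rho>: "\<rho> \<in> carrier_mat (2 ^ n) (2 ^ n)"
    using assms by (simp add: quantum_state_def)
  have "mat_trace (\<rho> * tensor n (\<lambda>q. pauli_projector (b q) (s q))) =
      (\<Sum>r<2^n. \<Sum>c<2^n. \<rho> $$ (r, c) * (u c * cnj (u r)))"
    by (simp add: mat_trace_mult[OF \<rho> tensor_carrier])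
      (simp add: tensor_def pauli_projector_index prod.distrib u_def)
  also have "\<dots> = (\<rho> *\<^sub>v vec (2 ^ n) u) \<bullet>c vec (2 ^ n) u"
    using \<rho> by (simp add: scalar_prod_def atLeast0LessThan sum_distrib_right mult.assoc)
  finally show ?thesis
    using assms by (simp add: quantum_state_def)
qed

lemma pauli_outcome_prob_sum:
  assumes "quantum_state n \<rho>"
  shows "(\<Sum>s | \<forall>q\<ge>n. \<not> s q.
    Re (mat_trace (\<rho> * tensor n (\<lambda>q. pauli_projector (b q) (s q))))) = 1"
proof -
  have \<rho>: "\<rho> \<in> carrier_mat (2 ^ n) (2 ^ n)" and tr: "mat_trace \<rho> = 1"
    using assms by (auto simp: quantum_state_def)
  let ?T = "\<lambda>s. tensor n (\<lambda>q. pauli_projector (b q) (s q))"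
  have "(\<Sum>s | \<forall>q\<ge>n. \<not> s q. mat_trace (\<rho> * ?T s)) =
      (\<Sum>s | \<forall>q\<ge>n. \<not> s q. \<Sum>r<2^n. \<Sum>c<2^n. \<rho> $$ (r, c) * ?T s $$ (c, r))"
    by (simp only: mat_trace_mult[OF \<rho> tensor_carrier])
  also have "\<dots> = (\<Sum>r<2^n. \<Sum>s | \<forall>q\<ge>n. \<not> s q. \<Sum>c<2^n. \<rho> $$ (r, c) * ?T s $$ (c, r))"
    by (rule sum.swap)
  also have "\<dots> = (\<Sum>r<2^n. \<Sum>c<2^n. \<Sum>s | \<forall>q\<ge>n. \<not> s q. \<rho> $$ (r, c) * ?T s $$ (c, r))"
    by (intro sum.cong refl sum.swap)
  also have "\<dots> = (\<Sum>r<2^n. \<Sum>c<2^n. \<rho> $$ (r, c) * (\<Sum>s | \<forall>q\<ge>n. \<not> s q. ?T s $$ (c, r)))"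
    by (simp only: sum_distrib_left)
  also have "\<dots> = (\<Sum>r<2^n. \<Sum>c<2^n. \<rho> $$ (r, c) * of_bool (c = r))"
    by (intro sum.cong refl, subst tensor_projector_complete) auto
  also have "\<dots> = mat_trace \<rho>"
    using \<rho> by (simp add: mat_trace_def of_bool_def if_distrib sum.delta cong: if_cong)
  finally show ?thesis
    using tr by (simp flip: Re_sum)
qed

lemma pmf_pauli_outcome:
  assumes "quantum_state n \<rho>"
  shows "pmf (pauli_outcome n \<rho> b) s = (if \<forall>q\<ge>n. \<not> s q
     then Re (mat_trace (\<rho> * tensor n (\<lambda>q. pauli_projector (b q) (s q)))) else 0)"
  unfolding pauli_outcome_def
proof (rule pmf_embed_pmf)
  let ?S = "{s :: nat \<Rightarrow> bool. \<forall>q\<ge>n. \<not> s q}"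
  let ?p = "\<lambda>s. Re (mat_trace (\<rho> * tensor n (\<lambda>q. pauli_projector (b q) (s q))))"
  have "(\<integral>\<^sup>+ s. ennreal (if \<forall>q\<ge>n. \<not> s q then ?p s else 0) \<partial>count_space UNIV) =
      (\<Sum>s\<in>?S. ennreal (?p s))"
    by (subst nn_integral_count_space'[where A = ?S]) (use finite_outcomes in auto)
  also have "\<dots> = 1"
    using pauli_outcome_prob_sum[OF assms]
    by (subst sum_ennreal) (auto intro: pauli_outcome_prob_nonneg[OF assms])
  finally show "(\<integral>\<^sup>+ s. ennreal (if \<forall>q\<ge>n. \<not> s q then ?p s else 0) \<partial>count_space UNIV) = 1" .
qed (use pauli_outcome_prob_nonneg[OF assms] in auto)

end

theory Submission
  imports Defs
begin

text \<open>
  Expand each observable in Pauli strings, \<open>O = (\<Sum>P. a P \<cdot> P)\<close>. The core is the norm inequality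
  \<open>(\<Sum>P. \<bar>a P\<bar>) \<le> K * spectral_norm O\<close> with \<open>K\<close> depending on \<open>k\<close> and \<open>d\<close> only. Only strings supported
  inside a single few-body term occur, so each qubit lies in at most \<open>d * 4 ^ k\<close> of them. Greedily
  choose strings carrying a constant fraction of the weight such that every occurring string meets
  at most one chosen string; in particular the chosen ones are disjoint and all diagonal in a common
  product basis \<open>b\<close>. The expectation of \<open>O\<close> in the eigenstates of \<open>b\<close> is a polynomial on the cube
  bounded by the spectral norm, and averaging it against the Riesz product of the chosen characters
  extracts the sum of the moduli of the chosen coefficients.

  A single run estimates \<open>tr (P \<rho>)\<close> by \<open>3 ^ \<bar>P\<bar>\<close> times the product of the outcomes on the support of \<open>P\<close>
  if its basis agrees with \<open>P\<close> there, and by \<open>0\<close> otherwise. By the norm inequality the resulting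
  estimate of \<open>tr (O \<rho>)\<close> is bounded by a constant times \<open>B\<close>, the largest spectral norm. Hoeffding's inequality is combined with a union bound over the \<open>M\<close> observables if
  \<open>M \<le> n\<close>, and otherwise over the at most \<open>(4 n) ^ k\<close> strings of weight at most \<open>k\<close>. When \<open>\<epsilon>\<close> exceeds
  a constant times \<open>B\<close>, the estimate \<open>0\<close> is good enough without any measurement.
\<close>

subsection \<open>Riesz products on the cube\<close>

lemma sum_prod_PiE_dflt:
  fixes g :: "'i \<Rightarrow> 'a \<Rightarrow> 'c::comm_semiring_1"
  assumes "finite I" "\<And>i. i \<in> I \<Longrightarrow> finite (B i)"
  shows "(\<Sum>f\<in>PiE_dflt I d B. \<Prod>i\<in>I. g i (f i)) = (\<Prod>i\<in>I. \<Sum>x\<in>B i. g i x)"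
proof -
  have "(\<Sum>f\<in>PiE_dflt I d B. \<Prod>i\<in>I. g i (f i)) = (\<Sum>f\<in>PiE I B. \<Prod>i\<in>I. g i (f i))"
    by (rule sum.reindex_bij_witness[where i = "\<lambda>f i. if i \<in> I then f i else d"
          and j = "\<lambda>f. restrict f I"])
      (auto simp: PiE_dflt_def extensional_def restrict_def fun_eq_iff)
  then show ?thesis
    using assms by (simp add: prod_sum_PiE)
qed

text \<open>Greedy choice: a heaviest \<open>v\<close> outweighs each of its at most
  \<open>D\<close> neighbours, so discarding \<open>v\<close> together with them loses at most
  \<open>(D + 1) * w v\<close>. The rest is handled by induction on the cardinality.\<close>

lemma exists_independent_heavy_subset:
  fixes w :: "'a \<Rightarrow> real"
  assumes "finite S" "\<And>x. x \<in> S \<Longrightarrow> 0 \<le> w x" "symp E"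
    and "\<And>x. x \<in> S \<Longrightarrow> card {y \<in> S. E x y} \<le> D"
  shows "\<exists>T\<subseteq>S. (\<forall>x\<in>T. \<forall>y\<in>T. E x y \<longrightarrow> x = y) \<and> (\<Sum>x\<in>S. w x) \<le> (real D + 1) * (\<Sum>x\<in>T. w x)"
  using assms
proof (induction "card S" arbitrary: S rule: less_induct)
  case less
  show ?case
  proof (cases "S = {}")
    case False
    then have "Max (w ` S) \<in> w ` S"
      using less.prems(1) by simp
    then obtain v where v: "v \<in> S" "w v = Max (w ` S)"
      by auto
    have w_le: "w x \<le> w v" if "x \<in> S" for x
      using that v(2) less.prems(1) by simp
    \<comment> \<open>\<open>E v v\<close> may fail, hence \<open>v\<close> is inserted explicitly;
      this is the \<open>+ 1\<close> in the factor.\<close>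
    define R where "R = insert v {y \<in> S. E v y}"
    have R: "R \<subseteq> S" "finite R" "v \<in> R"
      using v(1) less.prems(1) by (auto simp: R_def)
    have "card R \<le> D + 1"
      using less.prems(4)[OF v(1)] card_insert_le_m1[of "D + 1" "{y \<in> S. E v y}" v]
      by (simp add: R_def)
    have "card (S - R) < card S"
      using R v(1) less.prems(1) by (intro psubset_card_mono) auto
    moreover have "card {y \<in> S - R. E x y} \<le> D" if "x \<in> S - R" for x
    proof -
      have "card {y \<in> S - R. E x y} \<le> card {y \<in> S. E x y}"
        using less.prems(1) by (intro card_mono) auto
      also have "\<dots> \<le> D"
        using less.prems(4) that by simp
      finally show ?thesis .
    qed
    ultimately obtain T where T: "T \<subseteq> S - R" "\<forall>x\<in>T. \<forall>y\<in>T. E x y \<longrightarrow> x = y"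
      "(\<Sum>x\<in>S - R. w x) \<le> (real D + 1) * (\<Sum>x\<in>T. w x)"
      using less.hyps[of "S - R"] less.prems(1,2,3) by auto
    have "finite T"
      using T(1) less.prems(1) by (meson finite_Diff finite_subset)
    have "(\<Sum>x\<in>R. w x) \<le> real (card R) * w v"
      using R(1) w_le by (intro sum_bounded_above) auto
    also have "\<dots> \<le> (real D + 1) * w v"
      using \<open>card R \<le> D + 1\<close> less.prems(2)[OF v(1)] by (intro mult_right_mono) auto
    finally have "(\<Sum>x\<in>S. w x) \<le> (real D + 1) * w v + (real D + 1) * (\<Sum>x\<in>T. w x)"
      using T(3) R less.prems(1) by (simp add: sum.subset_diff[of R S])
    also have "\<dots> = (real D + 1) * (\<Sum>x\<in>insert v T. w x)"
      using T(1) R(3) \<open>finite T\<close> by (subst sum.insert) (auto simp: algebra_simps)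
    \<comment> \<open>No edge joins \<open>v\<close> and \<open>T\<close> in either direction:
      \<open>T\<close> avoids \<open>R\<close>, and \<open>E\<close> is symmetric.\<close>
    finally show ?thesis
      using T v(1) less.prems(3)
      by (intro exI[of _ "insert v T"]) (auto simp: R_def dest: sympD)
  qed auto
qed

section \<open>Walsh characters and Riesz products\<close>

definition outcomes :: "nat \<Rightarrow> (nat \<Rightarrow> bool) set" where
  "outcomes n = PiE_dflt {..<n} False (\<lambda>_. UNIV)"

definition outcome_sign :: "bool \<Rightarrow> real" where
  "outcome_sign s = (if s then - 1 else 1)"

text \<open>The Walsh character of \<open>A\<close>, with the outcomes read as signs.\<close>

definition chi :: "nat set \<Rightarrow> (nat \<Rightarrow> bool) \<Rightarrow> real" where
  "chi A s = (\<Prod>q\<in>A. outcome_sign (s q))"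

lemma finite_outcomes_PiE_dflt [simp]: "finite (outcomes n)"
  by (auto simp: outcomes_def)

lemma card_outcomes: "card (outcomes n) = 2 ^ n"
  by (simp add: outcomes_def card_PiE_dflt card_UNIV_bool)

text \<open>Links the product form, over which sums of products factor, to the outcome set used by
  \<open>pauli_outcome\<close>.\<close>

lemma outcomes_eq: "outcomes n = {s. \<forall>q\<ge>n. \<not> s q}"
  by (auto simp: outcomes_def PiE_dflt_def)

lemma outcome_sign_simps [simp]:
  "outcome_sign True = - 1" "outcome_sign False = 1" "outcome_sign (\<not> s) = - outcome_sign s"
  "outcome_sign s * outcome_sign s = 1" "\<bar>outcome_sign s\<bar> = 1"
  by (auto simp: outcome_sign_def)

lemma abs_chi [simp]: "\<bar>chi A s\<bar> = 1"
  by (simp add: chi_def abs_prod)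

lemma chi_empty [simp]: "chi {} s = 1"
  by (simp add: chi_def)

lemma chi_mult_self [simp]: "chi A s * chi A s = 1"
  by (simp add: chi_def flip: prod.distrib)

lemma chi_flip:
  assumes "finite A"
  shows "chi A (s(q := \<not> s q)) = (if q \<in> A then - chi A s else chi A s)"
proof (cases "q \<in> A")
  case True
  then show ?thesis
    using assms by (simp add: chi_def prod.remove[of A q])
qed (auto simp: chi_def intro!: prod.cong)

text \<open>Flipping \<open>q\<close> is an involution of the cube, so the terms cancel in
  pairs.\<close>

lemma sum_outcomes_eq_0_if_flip_neg:
  fixes f :: "(nat \<Rightarrow> bool) \<Rightarrow> real"
  assumes "q < n" "\<And>s. f (s(q := \<not> s q)) = - f s"
  shows "(\<Sum>s\<in>outcomes n. f s) = 0"
proof -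
  have "(\<Sum>s\<in>outcomes n. f s) = (\<Sum>s\<in>outcomes n. f (s(q := \<not> s q)))"
    by (rule sum.reindex_bij_witness[where i = "\<lambda>s. s(q := \<not> s q)" and j = "\<lambda>s. s(q := \<not> s q)"])
      (use assms(1) in \<open>auto simp: outcomes_eq\<close>)
  then show ?thesis
    by (simp add: assms(2) sum_negf)
qed

lemma sum_chi_mult_chi:
  assumes "A \<subseteq> {..<n}" "B \<subseteq> {..<n}"
  shows "(\<Sum>s\<in>outcomes n. chi A s * chi B s) = (if A = B then 2 ^ n else 0)"
proof (cases "A = B")
  case False
  \<comment> \<open>Flipping a coordinate that lies in exactly one of the two sets changes the sign
    of exactly one character.\<close>
  then obtain q where q: "q \<in> A \<and> q \<notin> B \<or> q \<in> B \<and> q \<notin> A"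
    by auto
  have "finite A" "finite B"
    using assms by (auto intro: finite_subset)
  then have "(\<Sum>s\<in>outcomes n. chi A s * chi B s) = 0"
    by (intro sum_outcomes_eq_0_if_flip_neg[of q]) (use q assms in \<open>auto simp: chi_flip\<close>)
  with False show ?thesis
    by simp
qed (simp add: card_outcomes)

lemma sum_chi:
  assumes "A \<subseteq> {..<n}"
  shows "(\<Sum>s\<in>outcomes n. chi A s) = (if A = {} then 2 ^ n else 0)"
  using sum_chi_mult_chi[OF assms, of "{}"] by simp

text \<open>For disjoint nonempty sets of coordinates and
  \<open>\<bar>\<sigma> A\<bar> \<le> 1\<close> this is a probability density with respect to the
  uniform distribution on the cube.\<close>

definition riesz_product :: "nat set set \<Rightarrow> (nat set \<Rightarrow> real) \<Rightarrow> (nat \<Rightarrow> bool) \<Rightarrow> real" where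
  "riesz_product T \<sigma> s = (\<Prod>A\<in>T. 1 + \<sigma> A * chi A s)"

lemma riesz_product_nonneg:
  assumes "\<And>A. A \<in> T \<Longrightarrow> \<bar>\<sigma> A\<bar> \<le> 1"
  shows "0 \<le> riesz_product T \<sigma> s"
  unfolding riesz_product_def
proof (rule prod_nonneg)
  fix A assume "A \<in> T"
  then have "\<bar>\<sigma> A * chi A s\<bar> \<le> 1"
    using assms by (simp add: abs_mult)
  then show "0 \<le> 1 + \<sigma> A * chi A s"
    by linarith
qed

text \<open>Factors are removed one at a time: flipping a point of \<open>A\<close> negates
  \<open>chi A\<close> and fixes both \<open>g\<close> and the remaining factors, whose sets are
  disjoint from \<open>A\<close>.\<close>

lemma sum_mult_riesz_product:
  assumes "finite T" "\<And>A. A \<in> T \<Longrightarrow> A \<noteq> {} \<and> A \<subseteq> {..<n}" "disjoint T"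
    and "\<And>q s. q \<in> \<Union>T \<Longrightarrow> g (s(q := \<not> s q)) = g s"
  shows "(\<Sum>s\<in>outcomes n. g s * riesz_product T \<sigma> s) = (\<Sum>s\<in>outcomes n. g s)"
  using assms
proof (induction T)
  case (insert A T)
  obtain q where q: "q \<in> A" "q < n"
    using insert.prems(1)[of A] by auto
  have fin: "finite B" if "B \<in> insert A T" for B
    using insert.prems(1)[OF that] by (auto intro: finite_subset)
  have q': "q \<notin> B" if "B \<in> T" for B
    using insert.prems(2) insert.hyps(2) q that by (auto simp: disjoint_def)
  have "riesz_product T \<sigma> (s(q := \<not> s q)) = riesz_product T \<sigma> s" for s
    unfolding riesz_product_def using q' fin by (intro prod.cong) (auto simp: chi_flip)
  moreover have g_flip: "g (s(q := \<not> s q)) = g s" for s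
    using insert.prems(3) q by blast
  ultimately have "(\<Sum>s\<in>outcomes n. chi A s * (g s * riesz_product T \<sigma> s)) = 0"
    using q fin by (intro sum_outcomes_eq_0_if_flip_neg[of q]) (auto simp: chi_flip g_flip)
  moreover have "(\<Sum>s\<in>outcomes n. g s * riesz_product T \<sigma> s) = (\<Sum>s\<in>outcomes n. g s)"
    using insert.prems by (intro insert.IH) (auto simp: disjoint_def)
  moreover have "(\<Sum>s\<in>outcomes n. g s * riesz_product (insert A T) \<sigma> s) =
      (\<Sum>s\<in>outcomes n. g s * riesz_product T \<sigma> s) +
      \<sigma> A * (\<Sum>s\<in>outcomes n. chi A s * (g s * riesz_product T \<sigma> s))"
    using insert.hyps by (simp add: riesz_product_def algebra_simps sum.distrib sum_distrib_left)
  ultimately show ?case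
    by simp
qed (simp add: riesz_product_def)

text \<open>At most one set of \<open>T\<close> meets \<open>V\<close>. The factors of all other
  sets average out, and orthogonality of characters evaluates what remains: \<open>chi V\<close>,
  multiplied by \<open>1 + \<sigma> A * chi A\<close> if some \<open>A\<close> meets
  \<open>V\<close>.\<close>

lemma sum_chi_mult_riesz_product:
  assumes T: "finite T" "\<And>A. A \<in> T \<Longrightarrow> A \<noteq> {} \<and> A \<subseteq> {..<n}" "disjoint T" and V: "V \<subseteq> {..<n}"
    and meets: "\<And>A B. A \<in> T \<Longrightarrow> B \<in> T \<Longrightarrow> A \<inter> V \<noteq> {} \<Longrightarrow> B \<inter> V \<noteq> {} \<Longrightarrow> A = B"
  shows "(\<Sum>s\<in>outcomes n. chi V s * riesz_product T \<sigma> s) =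
    2 ^ n * (of_bool (V = {}) + (if V \<in> T then \<sigma> V else 0))"
proof (cases "\<exists>A\<in>T. A \<inter> V \<noteq> {}")
  case False
  have "finite V"
    using V by (auto intro: finite_subset)
  then have "(\<Sum>s\<in>outcomes n. chi V s * riesz_product T \<sigma> s) = (\<Sum>s\<in>outcomes n. chi V s)"
    using False by (intro sum_mult_riesz_product T) (auto simp: chi_flip)
  moreover have "V \<notin> T"
    using False T(2) by auto
  ultimately show ?thesis
    using V by (simp add: sum_chi)
next
  case True
  then obtain A where A: "A \<in> T" "A \<inter> V \<noteq> {}"
    by auto
  have fin: "finite V" "finite A"
    using V T(2)[OF A(1)] by (auto intro: finite_subset)
  have "riesz_product T \<sigma> s = (1 + \<sigma> A * chi A s) * riesz_product (T - {A}) \<sigma> s" for s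
    unfolding riesz_product_def using A(1) T(1) by (simp add: prod.remove)
  then have "(\<Sum>s\<in>outcomes n. chi V s * riesz_product T \<sigma> s) =
      (\<Sum>s\<in>outcomes n. (chi V s + \<sigma> A * (chi A s * chi V s)) * riesz_product (T - {A}) \<sigma> s)"
    by (simp add: algebra_simps)
  also have "\<dots> = (\<Sum>s\<in>outcomes n. chi V s + \<sigma> A * (chi A s * chi V s))"
  proof (rule sum_mult_riesz_product)
    fix q s assume "q \<in> \<Union> (T - {A})"
    then obtain B where B: "B \<in> T" "B \<noteq> A" "q \<in> B"
      by auto
    have "q \<notin> V"
      using meets[OF B(1) A(1) _ A(2)] B(2,3) by auto
    moreover have "q \<notin> A"
      using disjointD[OF T(3) B(1) A(1) B(2)] B(3) by auto
    ultimately show "chi V (s(q := \<not> s q)) + \<sigma> A * (chi A (s(q := \<not> s q)) * chi V (s(q := \<not> s q))) =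
        chi V s + \<sigma> A * (chi A s * chi V s)"
      using fin by (simp add: chi_flip)
  qed (use T in \<open>auto simp: disjoint_def\<close>)
  also have "\<dots> = (if V = {} then 2 ^ n else 0) + \<sigma> A * (if A = V then 2 ^ n else 0)"
    using V T(2)[OF A(1)] by (simp add: sum.distrib sum_chi sum_chi_mult_chi flip: sum_distrib_left)
  finally have "(\<Sum>s\<in>outcomes n. chi V s * riesz_product T \<sigma> s) =
      (if V = {} then 2 ^ n else 0) + \<sigma> A * (if A = V then 2 ^ n else 0)" .
  moreover have "V \<noteq> {}"
    using A(2) by blast
  moreover from this have "V \<in> T \<longleftrightarrow> A = V"
    using A(1) meets[OF A(1) _ A(2), of V] by auto
  ultimately show ?thesis
    by simp
qed

text \<open>The Riesz product with the signs of the coefficients is nonnegative with mean 1, so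
  averaging the bounded polynomial against it gives at most \<open>b\<close>; this average is the
  left-hand side.\<close>

lemma sum_abs_fourier_coefficients_le:
  assumes T: "\<And>A. A \<in> T \<Longrightarrow> A \<noteq> {} \<and> A \<subseteq> {..<n}" "disjoint T"
    and meets: "\<And>A B V. A \<in> T \<Longrightarrow> B \<in> T \<Longrightarrow> V \<subseteq> {..<n} \<Longrightarrow> c V \<noteq> 0 \<Longrightarrow>
      A \<inter> V \<noteq> {} \<Longrightarrow> B \<inter> V \<noteq> {} \<Longrightarrow> A = B"
    and bound: "\<And>s. s \<in> outcomes n \<Longrightarrow> (\<Sum>V\<in>Pow {..<n}. c V * chi V s) \<le> b"
  shows "c {} + (\<Sum>A\<in>T. \<bar>c A\<bar>) \<le> b"
proof -
  define \<sigma> where "\<sigma> A = sgn (c A)" for A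
  have "T \<subseteq> Pow {..<n}"
    using T(1) by auto
  then have "finite T"
    by (rule finite_subset) simp
  \<comment> \<open>Where \<open>c V = 0\<close> both sides vanish, so \<open>meets\<close> is
    required only for characters that occur.\<close>
  have summand: "c V * (\<Sum>s\<in>outcomes n. chi V s * riesz_product T \<sigma> s) =
      2 ^ n * ((if V = {} then c {} else 0) + (if V \<in> T then \<bar>c V\<bar> else 0))" if "V \<in> Pow {..<n}" for V
  proof (cases "c V = 0")
    case False
    then show ?thesis
      using that meets[of _ _ V] T
      by (subst sum_chi_mult_riesz_product) (auto simp: \<open>finite T\<close> \<sigma>_def algebra_simps abs_sgn)
  qed auto
  have "2 ^ n * (c {} + (\<Sum>A\<in>T. \<bar>c A\<bar>)) =
      (\<Sum>V\<in>Pow {..<n}. c V * (\<Sum>s\<in>outcomes n. chi V s * riesz_product T \<sigma> s))"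
    using sum.inter_restrict[of "Pow {..<n}" "\<lambda>A. \<bar>c A\<bar>" T] \<open>T \<subseteq> Pow {..<n}\<close>
    by (simp add: summand sum.distrib Int_absorb1 flip: sum_distrib_left)
  also have "\<dots> = (\<Sum>V\<in>Pow {..<n}. \<Sum>s\<in>outcomes n. c V * chi V s * riesz_product T \<sigma> s)"
    by (simp add: sum_distrib_left mult.assoc)
  also have "\<dots> = (\<Sum>s\<in>outcomes n. (\<Sum>V\<in>Pow {..<n}. c V * chi V s) * riesz_product T \<sigma> s)"
    by (subst sum.swap) (simp add: sum_distrib_right)
  also have "\<dots> \<le> (\<Sum>s\<in>outcomes n. b * riesz_product T \<sigma> s)"
    by (intro sum_mono mult_right_mono bound riesz_product_nonneg) (auto simp: \<sigma>_def sgn_if)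
  also have "\<dots> = b * (\<Sum>s\<in>outcomes n. riesz_product T \<sigma> s)"
    by (simp add: sum_distrib_left)
  also have "(\<Sum>s\<in>outcomes n. riesz_product T \<sigma> s) = 2 ^ n"
    using sum_mult_riesz_product[of T n "\<lambda>_. 1" \<sigma>] T \<open>finite T\<close> by (simp add: card_outcomes)
  finally show ?thesis
    by (simp add: mult.commute)
qed

subsection \<open>Pauli strings\<close>

instantiation pauli :: finite
begin
instance
proof
  have "(UNIV :: pauli set) = {PauliX, PauliY, PauliZ}"
    using pauli.exhaust by blast
  then show "finite (UNIV :: pauli set)"
    by (metis finite.emptyI finite_insert)
qed
end

lemma UNIV_pauli: "(UNIV :: pauli set) = {PauliX, PauliY, PauliZ}"
  using pauli.exhaust by blast

lemma sum_pauli_option: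
  fixes f :: "pauli option \<Rightarrow> 'a::comm_monoid_add"
  shows "(\<Sum>p\<in>UNIV. f p) = f None + (f (Some PauliX) + (f (Some PauliY) + f (Some PauliZ)))"
  by (simp add: UNIV_option_conv UNIV_pauli sum.reindex)

text \<open>The bits identify the indices below \<open>2 ^ n\<close> with the cube. In the induction
  step the top bit separates the lower half of the range from its shift by
  \<open>2 ^ n\<close>.\<close>

lemma sum_prod_bits:
  fixes f :: "nat \<Rightarrow> bool \<Rightarrow> 'a::comm_semiring_1"
  shows "(\<Sum>r<(2::nat)^n. \<Prod>q<n. f q (bit r q)) = (\<Prod>q<n. \<Sum>x\<in>UNIV. f q x)"
proof (induction n)
  case (Suc n)
  have low: "bit (r + 2 ^ n) q = bit r q" if "q < n" for r q :: nat
  proof -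
    have "(2::nat) ^ n = 2 ^ Suc (n - Suc q) * 2 ^ q"
      using that by (subst power_add[symmetric]) simp
    then have "(r + 2 ^ n) div 2 ^ q = r div 2 ^ q + 2 ^ Suc (n - Suc q)"
      by simp
    then show ?thesis
      by (simp add: bit_iff_odd)
  qed
  have high: "\<not> bit r n" "bit (r + 2 ^ n) n" if "r < 2 ^ n" for r :: nat
    using that by (simp_all add: bit_iff_odd)
  have split: "(\<Sum>r<m + m. h r) = (\<Sum>r<m. h r) + (\<Sum>r<m. h (r + m))"
    for h :: "nat \<Rightarrow> 'a" and m
    using sum.atLeastLessThan_concat[of 0 m "m + m" h] sum.shift_bounds_nat_ivl[of h 0 m m]
    by (simp add: lessThan_atLeast0)
  have "(\<Sum>r<(2::nat)^Suc n. \<Prod>q<Suc n. f q (bit r q)) =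
      (\<Sum>r<(2::nat)^n. \<Prod>q<Suc n. f q (bit r q)) + (\<Sum>r<(2::nat)^n. \<Prod>q<Suc n. f q (bit (r + 2 ^ n) q))"
    by (simp only: power_Suc mult_2 split)
  also have "\<dots> = (\<Sum>r<(2::nat)^n. \<Prod>q<n. f q (bit r q)) * f n False +
      (\<Sum>r<(2::nat)^n. \<Prod>q<n. f q (bit r q)) * f n True"
    by (simp add: high low sum_distrib_right)
  finally show ?case
    by (simp add: Suc UNIV_bool algebra_simps)
qed simp

fun local_pauli_mat :: "pauli option \<Rightarrow> complex mat" where
  "local_pauli_mat None = 1\<^sub>m 2"
| "local_pauli_mat (Some p) = pauli_mat p"

definition pauli_string :: "nat \<Rightarrow> (nat \<Rightarrow> pauli option) \<Rightarrow> complex mat" where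
  "pauli_string n P = tensor n (\<lambda>q. local_pauli_mat (P q))"

text \<open>A string is a partial map in which \<open>None\<close> stands for the identity factor,
  so \<open>dom P\<close> is its support and \<open>card (dom P)\<close> its weight.\<close>

definition strings :: "nat \<Rightarrow> (nat \<Rightarrow> pauli option) set" where
  "strings n = {P. dom P \<subseteq> {..<n}}"

lemma strings_eq: "strings n = PiE_dflt {..<n} None (\<lambda>_. UNIV)"
  by (auto simp: strings_def PiE_dflt_def dom_def)

lemma finite_strings [simp]: "finite (strings n)"
  by (auto simp: strings_eq)

text \<open>The coefficient in the Pauli expansion: the strings are orthogonal for the trace inner
  product, each with squared norm \<open>2 ^ n\<close>.\<close>

definition pauli_coeff :: "nat \<Rightarrow> complex mat \<Rightarrow> (nat \<Rightarrow> pauli option) \<Rightarrow> complex" where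
  "pauli_coeff n A P = mat_trace (A * pauli_string n P) / 2 ^ n"

lemma pauli_string_carrier [simp]: "pauli_string n P \<in> carrier_mat (2 ^ n) (2 ^ n)"
  by (simp add: pauli_string_def tensor_carrier)

lemma pauli_string_index:
  assumes "r < 2 ^ n" "c < 2 ^ n"
  shows "pauli_string n P $$ (r, c) =
    (\<Prod>q<n. local_pauli_mat (P q) $$ (of_bool (bit r q), of_bool (bit c q)))"
  using assms by (simp add: pauli_string_def tensor_def)

text \<open>Entrywise form of the identity \<open>(\<Sum>p. p \<otimes> p) = 2 * SWAP\<close> on two
  qubits.\<close>

lemma local_pauli_mat_complete:
  "(\<Sum>p\<in>UNIV. local_pauli_mat p $$ (of_bool x, of_bool y) * local_pauli_mat p $$ (of_bool x', of_bool y')) =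
    2 * of_bool (x = y' \<and> y = x')"
  by (cases x; cases y; cases x'; cases y')
    (auto simp: sum_pauli_option mat_of_rows_list_def)

text \<open>The sum over strings factors over the qubits into single-qubit identities; agreement of
  all bits is equality of indices.\<close>

lemma pauli_string_complete:
  assumes "r < 2 ^ n" "c < 2 ^ n" "r' < 2 ^ n" "c' < 2 ^ n"
  shows "(\<Sum>P\<in>strings n. pauli_string n P $$ (r, c) * pauli_string n P $$ (r', c')) =
    2 ^ n * of_bool (r = c' \<and> c = r')"
proof -
  let ?g = "\<lambda>q p. local_pauli_mat p $$ (of_bool (bit r q), of_bool (bit c q)) *
      local_pauli_mat p $$ (of_bool (bit r' q), of_bool (bit c' q))"
  have "(\<Sum>P\<in>strings n. pauli_string n P $$ (r, c) * pauli_string n P $$ (r', c')) =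
      (\<Sum>P\<in>strings n. \<Prod>q<n. ?g q (P q))"
    using assms by (simp only: pauli_string_index prod.distrib)
  also have "\<dots> = (\<Prod>q<n. \<Sum>p\<in>UNIV. ?g q p)"
    unfolding strings_eq by (rule sum_prod_PiE_dflt) auto
  also have "\<dots> = (\<Prod>q<n. 2 * of_bool (bit r q = bit c' q \<and> bit c q = bit r' q))"
    by (simp only: local_pauli_mat_complete)
  also have "\<dots> = 2 ^ n * (\<Prod>q<n. of_bool (bit r q = bit c' q \<and> bit c q = bit r' q))"
    by (simp add: prod.distrib)
  also have "(\<Prod>q<n. of_bool (bit r q = bit c' q \<and> bit c q = bit r' q)) =
      (of_bool (r = c' \<and> c = r') :: complex)"
    using nat_eq_if_bits_eq[OF assms(1,4)] nat_eq_if_bits_eq[OF assms(2,3)]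
    by (auto simp: prod_zero_iff)
  finally show ?thesis .
qed

text \<open>The completeness relation contracts the product of two traces to a single one. Here
  \<open>\<rho>\<close> is any matrix of the right size; the lemma is applied to states and to
  eigenprojectors.\<close>

lemma trace_mult_eq_sum_pauli:
  assumes A: "A \<in> carrier_mat (2 ^ n) (2 ^ n)" and \<rho>: "\<rho> \<in> carrier_mat (2 ^ n) (2 ^ n)"
  shows "mat_trace (A * \<rho>) = (\<Sum>P\<in>strings n. pauli_coeff n A P * mat_trace (\<rho> * pauli_string n P))"
proof -
  let ?N = "2 ^ n :: nat"
  let ?t = "\<lambda>r c r' c' P. A $$ (r, c) * \<rho> $$ (r', c') *
      (pauli_string n P $$ (c, r) * pauli_string n P $$ (c', r'))"
  have "2 ^ n * (\<Sum>P\<in>strings n. pauli_coeff n A P * mat_trace (\<rho> * pauli_string n P)) =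
      (\<Sum>P\<in>strings n. (\<Sum>r<?N. \<Sum>c<?N. A $$ (r, c) * pauli_string n P $$ (c, r)) *
        (\<Sum>r'<?N. \<Sum>c'<?N. \<rho> $$ (r', c') * pauli_string n P $$ (c', r')))"
    by (simp add: pauli_coeff_def sum_distrib_left mat_trace_mult[OF A pauli_string_carrier]
        mat_trace_mult[OF \<rho> pauli_string_carrier])
  also have "\<dots> = (\<Sum>P\<in>strings n. \<Sum>r<?N. \<Sum>c<?N. \<Sum>r'<?N. \<Sum>c'<?N. ?t r c r' c' P)"
    by (simp only: sum_distrib_right) (simp only: sum_distrib_left mult_ac)
  also have "\<dots> = (\<Sum>r<?N. \<Sum>c<?N. \<Sum>r'<?N. \<Sum>c'<?N. \<Sum>P\<in>strings n. ?t r c r' c' P)"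
    by (simp only: sum.swap[of _ "{..<?N}" "strings n"])
  also have "\<dots> = (\<Sum>r<?N. \<Sum>c<?N. \<Sum>r'<?N. \<Sum>c'<?N.
      if c' = r then if r' = c then 2 ^ n * (A $$ (r, c) * \<rho> $$ (c, r)) else 0 else 0)"
    by (intro sum.cong refl) (simp add: pauli_string_complete flip: sum_distrib_left)
  also have "\<dots> = (\<Sum>r<?N. \<Sum>c<?N. 2 ^ n * (A $$ (r, c) * \<rho> $$ (c, r)))"
    by simp
  also have "\<dots> = 2 ^ n * mat_trace (A * \<rho>)"
    by (simp add: mat_trace_mult[OF A \<rho>] sum_distrib_left)
  finally show ?thesis
    by simp
qed

text \<open>Both factors are Hermitian, so conjugation transposes both, and exchanging the two
  summation indices restores the trace.\<close>

lemma trace_mult_pauli_string_real: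
  assumes "A \<in> carrier_mat (2 ^ n) (2 ^ n)" "mat_adjoint A = A"
  shows "mat_trace (A * pauli_string n P) \<in> \<real>"
proof -
  have adj: "mat_adjoint A $$ (c, r) = cnj (A $$ (r, c))" if "r < 2 ^ n" "c < 2 ^ n" for r c
    using that assms(1) by (simp add: mat_adjoint_def mat_of_rows_index)
  have sym: "cnj (A $$ (r, c)) = A $$ (c, r)" if "r < 2 ^ n" "c < 2 ^ n" for r c
    using adj[OF that] assms(2) by simp
  have "cnj (local_pauli_mat p $$ (of_bool x, of_bool y)) = local_pauli_mat p $$ (of_bool y, of_bool x)" for p x y
    by (cases p; cases "the p"; cases x; cases y)
      (auto simp: mat_of_rows_list_def)
  then have sym': "cnj (pauli_string n P $$ (r, c)) = pauli_string n P $$ (c, r)"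
    if "r < 2 ^ n" "c < 2 ^ n" for r c
    using that by (simp add: pauli_string_index)
  have "cnj (mat_trace (A * pauli_string n P)) =
      (\<Sum>r<2^n. \<Sum>c<2^n. A $$ (c, r) * pauli_string n P $$ (r, c))"
    by (simp add: mat_trace_mult[OF assms(1) pauli_string_carrier] sym sym')
  also have "\<dots> = mat_trace (A * pauli_string n P)"
    by (subst sum.swap) (simp add: mat_trace_mult[OF assms(1) pauli_string_carrier])
  finally show ?thesis
    by (simp add: Reals_cnj_iff)
qed

lemma flip_bit_nat_less:
  fixes r :: nat
  assumes "r < 2 ^ n" "q < n"
  shows "flip_bit q r < 2 ^ n"
proof -
  have "take_bit n r = r"
    using assms(1) by (simp add: take_bit_nat_eq_self_iff)
  then have "take_bit n (flip_bit q r) = flip_bit q r"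
    using assms(2) by (simp add: take_bit_flip_bit_eq)
  then show ?thesis
    by (simp add: take_bit_nat_eq_self_iff)
qed

lemma del_bit_flip_bit: "del_bit q (flip_bit q r) = del_bit q r"
proof -
  have "take_bit q (flip_bit q r) = take_bit q r"
    by (simp add: take_bit_flip_bit_eq)
  moreover have "drop_bit (Suc q) (flip_bit q r) = drop_bit (Suc q) r"
    by (intro bit_eqI) (auto simp: bit_simps)
  ultimately show ?thesis
    by (simp only: del_bit_def take_bit_eq_mod drop_bit_eq_div)
qed

lemma trace_mult_pauli_string_eq_0:
  assumes "acts_trivially n q A" "q < n" "P q \<noteq> None"
  shows "mat_trace (A * pauli_string n P) = 0"
proof -
  txt \<open>Flipping bit \<open>q\<close> of both indices negates every summand of the trace.\<close>
  obtain A' where A: "A = mat (2 ^ n) (2 ^ n)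
      (\<lambda>(r, c). of_bool (bit r q = bit c q) * A' $$ (del_bit q r, del_bit q c))"
    using assms(1) by (auto simp: acts_trivially_def)
  define f where "f = (flip_bit q :: nat \<Rightarrow> nat)"
  define t where "t r c = A $$ (r, c) * pauli_string n P $$ (c, r)" for r c
  have f_less: "f r < 2 ^ n" if "r < 2 ^ n" for r
    using that assms(2) by (simp add: f_def flip_bit_nat_less)
  have f_f [simp]: "f (f r) = r" for r
    by (auto simp: f_def bit_eq_iff bit_simps)
  have t_flip: "t (f r) (f c) = - t r c" if "r < 2 ^ n" "c < 2 ^ n" for r c
  proof (cases "bit r q = bit c q")
    case True
    have bit_f: "bit (f x) p = (if p = q then \<not> bit x p else bit x p)" for x p
      by (auto simp: f_def bit_simps)
    have string: "pauli_string n P $$ (c, r) =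
        local_pauli_mat (P q) $$ (of_bool (bit c q), of_bool (bit r q)) *
        (\<Prod>p\<in>{..<n} - {q}. local_pauli_mat (P p) $$ (of_bool (bit c p), of_bool (bit r p)))"
      if "r < 2 ^ n" "c < 2 ^ n" for r c
      using that assms(2) by (simp add: pauli_string_index prod.remove[of _ q])
    obtain p where "P q = Some p"
      using assms(3) by auto
    \<comment> \<open>The two bits agree, so these are diagonal entries: zero for X and Y, of
      opposite signs for Z.\<close>
    then have "local_pauli_mat (P q) $$ (of_bool (\<not> bit c q), of_bool (\<not> bit r q)) =
        - local_pauli_mat (P q) $$ (of_bool (bit c q), of_bool (bit r q))"
      using True by (cases p) (auto simp: mat_of_rows_list_def)
    then have "pauli_string n P $$ (f c, f r) = - pauli_string n P $$ (c, r)"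
      using that f_less by (simp add: string bit_f)
    moreover have "A $$ (f r, f c) = A $$ (r, c)"
      using that f_less[OF that(1)] f_less[OF that(2)] True
      by (simp add: A bit_f) (simp add: f_def del_bit_flip_bit)
    ultimately show ?thesis
      by (simp add: t_def)
  next
    case False
    then show ?thesis
      using that f_less[OF that(1)] f_less[OF that(2)]
      by (simp add: t_def A) (simp add: f_def bit_simps)
  qed
  have "(\<Sum>r<2^n. \<Sum>c<2^n. t r c) = (\<Sum>r<2^n. \<Sum>c<2^n. t (f r) (f c))"
    by (rule sum.reindex_bij_witness[where i = f and j = f])
      (auto simp: f_less intro!: sum.reindex_bij_witness[where i = f and j = f])
  also have "\<dots> = - (\<Sum>r<2^n. \<Sum>c<2^n. t r c)"
    by (simp add: t_flip sum_negf)
  finally have "(\<Sum>r<2^n. \<Sum>c<2^n. t r c) = 0"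
    by simp
  moreover have "A \<in> carrier_mat (2 ^ n) (2 ^ n)"
    by (simp add: A)
  ultimately show ?thesis
    by (simp add: mat_trace_mult t_def)
qed

subsection \<open>The norm inequality\<close>

text \<open>The expectation of \<open>p\<close> in the eigenstate of \<open>b\<close> with outcome
  \<open>s\<close>; distinct Pauli bases are mutually unbiased, hence the value 0.\<close>

definition pauli_value :: "pauli option \<Rightarrow> pauli \<Rightarrow> bool \<Rightarrow> real" where
  "pauli_value p b s = (case p of None \<Rightarrow> 1 | Some p' \<Rightarrow> if p' = b then outcome_sign s else 0)"

definition string_value ::
    "nat \<Rightarrow> (nat \<Rightarrow> pauli option) \<Rightarrow> (nat \<Rightarrow> pauli) \<Rightarrow> (nat \<Rightarrow> bool) \<Rightarrow> real" where
  "string_value n P b s = (\<Prod>q<n. pauli_value (P q) (b q) (s q))"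

definition eigenprojector :: "nat \<Rightarrow> (nat \<Rightarrow> pauli) \<Rightarrow> (nat \<Rightarrow> bool) \<Rightarrow> complex mat" where
  "eigenprojector n b s = tensor n (\<lambda>q. pauli_projector (b q) (s q))"

text \<open>Both index sums factor over the qubits by \<open>sum_prod_bits\<close>, first the inner,
  then the outer.\<close>

lemma mat_trace_tensor_mult:
  "mat_trace (tensor n A * tensor n B) =
    (\<Prod>q<n. \<Sum>x\<in>UNIV. \<Sum>y\<in>UNIV. A q $$ (of_bool x, of_bool y) * B q $$ (of_bool y, of_bool x))"
proof -
  have "mat_trace (tensor n A * tensor n B) = (\<Sum>r<(2::nat)^n. \<Sum>c<(2::nat)^n. \<Prod>q<n.
      A q $$ (of_bool (bit r q), of_bool (bit c q)) * B q $$ (of_bool (bit c q), of_bool (bit r q)))"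
    by (simp add: mat_trace_mult[OF tensor_carrier tensor_carrier]) (simp add: tensor_def prod.distrib)
  also have "\<dots> = (\<Sum>r<(2::nat)^n. \<Prod>q<n. \<Sum>y\<in>UNIV.
      A q $$ (of_bool (bit r q), of_bool y) * B q $$ (of_bool y, of_bool (bit r q)))"
    by (intro sum.cong refl sum_prod_bits)
  also have "\<dots> = (\<Prod>q<n. \<Sum>x\<in>UNIV. \<Sum>y\<in>UNIV.
      A q $$ (of_bool x, of_bool y) * B q $$ (of_bool y, of_bool x))"
    by (rule sum_prod_bits)
  finally show ?thesis .
qed

lemma trace_projector_local_pauli_mat:
  "(\<Sum>x\<in>UNIV. \<Sum>y\<in>UNIV. pauli_projector b s $$ (of_bool x, of_bool y) *
    local_pauli_mat p $$ (of_bool y, of_bool x)) = of_real (pauli_value p b s)"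
  by (cases p; cases "the p"; cases b; cases s)
    (auto simp: UNIV_bool pauli_value_def pauli_projector_def mat_of_rows_list_def)

lemma trace_eigenprojector_string:
  "mat_trace (eigenprojector n b s * pauli_string n P) = of_real (string_value n P b s)"
  by (simp add: eigenprojector_def pauli_string_def mat_trace_tensor_mult trace_projector_local_pauli_mat
      string_value_def)

lemma trace_mult_eigenprojector:
  assumes "A \<in> carrier_mat (2 ^ n) (2 ^ n)"
  shows "mat_trace (A * eigenprojector n b s) =
    (\<Sum>P\<in>strings n. pauli_coeff n A P * of_real (string_value n P b s))"
  using trace_mult_eq_sum_pauli[OF assms, of "eigenprojector n b s"]
  by (simp add: trace_eigenprojector_string) (simp add: eigenprojector_def tensor_carrier)

lemma string_value_eq:
  assumes "P \<in> strings n"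
  shows "string_value n P b s = (if P \<subseteq>\<^sub>m Some \<circ> b then chi (dom P) s else 0)"
proof -
  have P: "P q = None" if "\<not> q < n" for q
    using assms that by (auto simp: strings_def dom_def)
  show ?thesis
  proof (cases "P \<subseteq>\<^sub>m Some \<circ> b")
    case True
    then have "pauli_value (P q) (b q) (s q) = (if q \<in> dom P then outcome_sign (s q) else 1)" for q
      by (auto simp: map_le_def pauli_value_def dom_def split: option.splits)
    then have "string_value n P b s = (\<Prod>q<n. if q \<in> dom P then outcome_sign (s q) else 1)"
      by (simp add: string_value_def)
    also have "\<dots> = (\<Prod>q\<in>{..<n} \<inter> dom P. outcome_sign (s q))"
      by (rule prod.inter_restrict[symmetric]) simp
    also have "{..<n} \<inter> dom P = dom P"
      using assms by (auto simp: strings_def)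
    finally show ?thesis
      using True by (simp add: chi_def)
  next
    case False
    then obtain q p where q: "P q = Some p" "p \<noteq> b q"
      by (auto simp: map_le_def)
    then have "q < n"
      using P[of q] by fastforce
    then show ?thesis
      using False q by (auto simp: string_value_def pauli_value_def intro!: prod_zero bexI[of _ q])
  qed
qed

text \<open>In a fixed basis \<open>b\<close> only the strings that agree with \<open>b\<close> on
  their support survive. Each is determined by its support \<open>V\<close>, so the sum is a
  polynomial in Walsh characters.\<close>

lemma sum_string_value:
  fixes a :: "(nat \<Rightarrow> pauli option) \<Rightarrow> real"
  shows "(\<Sum>P\<in>strings n. a P * string_value n P b s) =
    (\<Sum>V\<in>Pow {..<n}. a ((Some \<circ> b) |` V) * chi V s)"
proof -
  have "(\<Sum>P\<in>strings n. a P * string_value n P b s) =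
      (\<Sum>P\<in>{P \<in> strings n. P \<subseteq>\<^sub>m Some \<circ> b}. a P * chi (dom P) s)"
    by (simp add: string_value_eq if_distrib sum.inter_filter cong: if_cong)
  also have "\<dots> = (\<Sum>V\<in>Pow {..<n}. a ((Some \<circ> b) |` V) * chi V s)"
  proof (rule sum.reindex_bij_witness[where i = "\<lambda>V. (Some \<circ> b) |` V" and j = dom])
    fix P assume "P \<in> {P \<in> strings n. P \<subseteq>\<^sub>m Some \<circ> b}"
    then show "(Some \<circ> b) |` dom P = P"
      by (auto simp: map_le_def restrict_map_def fun_eq_iff dom_def)
    then show "a ((Some \<circ> b) |` dom P) * chi (dom P) s = a P * chi (dom P) s"
      by simp
  qed (auto simp: strings_def map_le_def dom_def restrict_map_def split: if_splits)
  finally show ?thesis .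
qed

text \<open>The constant: the greedy selection loses a factor \<open>(k * m)\<^sup>2 + 1\<close>,
  the chosen weight is at most \<open>2 * B\<close>, and the identity string adds
  \<open>B\<close>.\<close>

lemma sum_abs_pauli_coeff_le:
  fixes a :: "(nat \<Rightarrow> pauli option) \<Rightarrow> real"
  assumes k: "\<And>P. P \<in> strings n \<Longrightarrow> a P \<noteq> 0 \<Longrightarrow> card (dom P) \<le> k"
    and m: "\<And>q. q < n \<Longrightarrow> card {P \<in> strings n. a P \<noteq> 0 \<and> q \<in> dom P} \<le> m"
    and bound: "\<And>b s. \<bar>\<Sum>P\<in>strings n. a P * string_value n P b s\<bar> \<le> B"
  shows "(\<Sum>P\<in>strings n. \<bar>a P\<bar>) \<le> (2 * (real (k * m))\<^sup>2 + 3) * B"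
proof -
  define S where "S = {P \<in> strings n. a P \<noteq> 0}"
  \<comment> \<open>A Riesz product takes nonempty sets only; the coefficient of the identity string
    is bounded separately.\<close>
  define S' where "S' = S - {Map.empty}"
  define meet where "meet P Q \<longleftrightarrow> dom P \<inter> dom Q \<noteq> {}" for P Q :: "nat \<Rightarrow> pauli option"
  \<comment> \<open>Two strings conflict if one occurring string meets both. Independence for
    \<open>E\<close> thus yields the condition \<open>meets\<close> of
    \<open>sum_abs_fourier_coefficients_le\<close>.\<close>
  define E where "E P P' \<longleftrightarrow> (\<exists>Q\<in>S. meet P Q \<and> meet Q P')" for P P'
  have [simp]: "finite S" "finite S'"
    by (simp_all add: S_def S'_def)
  have dom_less: "dom P \<subseteq> {..<n}" if "P \<in> S" for P
    using that by (auto simp: S_def strings_def)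
  have card_meet: "card {Q \<in> S. meet P Q} \<le> k * m" if P: "P \<in> S" for P
  proof -
    have "{Q \<in> S. meet P Q} = (\<Union>q\<in>dom P. {Q \<in> strings n. a Q \<noteq> 0 \<and> q \<in> dom Q})"
      by (auto simp: meet_def S_def)
    also have "card \<dots> \<le> (\<Sum>q\<in>dom P. card {Q \<in> strings n. a Q \<noteq> 0 \<and> q \<in> dom Q})"
      using dom_less[OF P] by (intro card_UN_le) (auto intro: finite_subset)
    also have "\<dots> \<le> (\<Sum>q\<in>dom P. m)"
      using dom_less[OF P] by (intro sum_mono m) auto
    also have "\<dots> \<le> k * m"
      using P k[of P] by (simp add: S_def)
    finally show ?thesis .
  qed
  have "card {P' \<in> S'. E P P'} \<le> (k * m) * (k * m)" if P: "P \<in> S'" for P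
  proof -
    \<comment> \<open>There are at most \<open>k * m\<close> intermediate strings \<open>Q\<close>,
      and each meets at most \<open>k * m\<close> strings.\<close>
    have "{P' \<in> S'. E P P'} \<subseteq> (\<Union>Q\<in>{Q \<in> S. meet P Q}. {P' \<in> S. meet Q P'})"
      by (auto simp: E_def S'_def)
    then have "card {P' \<in> S'. E P P'} \<le> card (\<Union>Q\<in>{Q \<in> S. meet P Q}. {P' \<in> S. meet Q P'})"
      by (intro card_mono) auto
    also have "\<dots> \<le> (\<Sum>Q\<in>{Q \<in> S. meet P Q}. card {P' \<in> S. meet Q P'})"
      by (intro card_UN_le) auto
    also have "\<dots> \<le> (\<Sum>Q\<in>{Q \<in> S. meet P Q}. k * m)"
      by (intro sum_mono card_meet) auto
    also have "\<dots> \<le> (k * m) * (k * m)"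
      using card_meet[of P] P by (auto simp: S'_def intro!: mult_right_mono)
    finally show ?thesis .
  qed
  moreover have "symp E"
    unfolding symp_def E_def meet_def by (metis Int_commute)
  ultimately obtain T where T: "T \<subseteq> S'" "\<And>P P'. P \<in> T \<Longrightarrow> P' \<in> T \<Longrightarrow> E P P' \<Longrightarrow> P = P'"
    and heavy: "(\<Sum>P\<in>S'. \<bar>a P\<bar>) \<le> (real (k * m * (k * m)) + 1) * (\<Sum>P\<in>T. \<bar>a P\<bar>)"
    using exists_independent_heavy_subset[of S' "\<lambda>P. \<bar>a P\<bar>" E "k * m * (k * m)"] by auto
  have T_S: "P \<in> S" "dom P \<noteq> {}" if "P \<in> T" for P
    using that T(1) by (auto simp: S'_def)
  have disj: "P = P'" if "P \<in> T" "P' \<in> T" "q \<in> dom P" "q \<in> dom P'" for P P' q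
  proof (rule T(2)[OF that(1,2)])
    \<comment> \<open>Overlapping strings conflict, with \<open>P\<close> itself as the string that
      meets both.\<close>
    show "E P P'"
      unfolding E_def meet_def using that T_S[OF that(1)] by (intro bexI[of _ P]) auto
  qed
  \<comment> \<open>A common basis: at most one chosen string has a letter at \<open>q\<close>, and
    that letter is taken; elsewhere the value is arbitrary.\<close>
  define b where "b q = (SOME p. \<exists>P\<in>T. P q = Some p)" for q
  have b: "P q = Some (b q)" if P: "P \<in> T" "q \<in> dom P" for P q
  proof -
    obtain p where "P q = Some p"
      using P(2) by auto
    then have "\<exists>P\<in>T. P q = Some (b q)"
      unfolding b_def using P(1) by (intro someI[of "\<lambda>p. \<exists>P\<in>T. P q = Some p" p]) auto
    then show ?thesis
      using disj[OF P(1) _ P(2)] by blast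
  qed
  define c where "c V = a ((Some \<circ> b) |` V)" for V
  have c_dom: "c (dom P) = a P" if "P \<in> T" for P
  proof -
    have "((Some \<circ> b) |` dom P) q = P q" for q
      using b[OF that, of q] by (cases "q \<in> dom P") (auto simp: domIff)
    then have "(Some \<circ> b) |` dom P = P" ..
    then show ?thesis
      by (simp add: c_def)
  qed
  have bound': "\<bar>\<Sum>V\<in>Pow {..<n}. c V * chi V s\<bar> \<le> B" for s
    using bound[of b s] by (simp add: sum_string_value c_def)
  \<comment> \<open>With no sets selected the Riesz product is 1, so plain averaging bounds the
    constant coefficient; this is applied to \<open>c\<close> and to its negative.\<close>
  have c_empty: "\<bar>c {}\<bar> \<le> B"
  proof -
    have "c {} \<le> B"
      using sum_abs_fourier_coefficients_le[of "{}" n c B] bound' by (simp add: abs_le_iff)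
    moreover have "- c {} \<le> B"
      using sum_abs_fourier_coefficients_le[of "{}" n "\<lambda>V. - c V" B] bound'
      by (simp add: abs_le_iff sum_negf)
    ultimately show ?thesis
      by simp
  qed
  have "c {} + (\<Sum>A\<in>dom ` T. \<bar>c A\<bar>) \<le> B"
  proof (rule sum_abs_fourier_coefficients_le)
    show "disjoint (dom ` T)"
      using disj by (fastforce simp: disjoint_def)
    show "A \<noteq> {} \<and> A \<subseteq> {..<n}" if "A \<in> dom ` T" for A
      using that T_S dom_less by blast
    show "A = A'" if A: "A \<in> dom ` T" "A' \<in> dom ` T" and V: "V \<subseteq> {..<n}" "c V \<noteq> 0"
      and meets: "A \<inter> V \<noteq> {}" "A' \<inter> V \<noteq> {}" for A A' V
    proof -
      obtain P P' where P: "P \<in> T" "A = dom P" "P' \<in> T" "A' = dom P'"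
        using A by auto
      have "dom ((Some \<circ> b) |` V) = V"
        by (auto simp: restrict_map_def dom_def)
      then have "E P P'"
        unfolding E_def meet_def S_def strings_def using V meets P
        by (intro bexI[of _ "(Some \<circ> b) |` V"]) (auto simp: c_def)
      then show ?thesis
        using T(2) P by auto
    qed
    show "(\<Sum>V\<in>Pow {..<n}. c V * chi V s) \<le> B" for s
      using bound'[of s] by simp
  qed
  moreover have "(\<Sum>A\<in>dom ` T. \<bar>c A\<bar>) = (\<Sum>P\<in>T. \<bar>a P\<bar>)"
  proof (subst sum.reindex)
    show "inj_on dom T"
      using disj T_S(2) by (fastforce simp: inj_on_def)
  qed (simp add: c_dom)
  \<comment> \<open>\<open>c {}\<close> may be as low as \<open>- B\<close>, hence the bound
    \<open>2 * B\<close>.\<close>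
  ultimately have "(\<Sum>P\<in>T. \<bar>a P\<bar>) \<le> 2 * B"
    using c_empty by simp
  then have "(real (k * m * (k * m)) + 1) * (\<Sum>P\<in>T. \<bar>a P\<bar>) \<le> (real (k * m * (k * m)) + 1) * (2 * B)"
    by (intro mult_left_mono) auto
  with heavy have "(\<Sum>P\<in>S'. \<bar>a P\<bar>) \<le> (real (k * m * (k * m)) + 1) * (2 * B)"
    by simp
  moreover have "(\<Sum>P\<in>strings n. \<bar>a P\<bar>) = \<bar>a Map.empty\<bar> + (\<Sum>P\<in>strings n - {Map.empty}. \<bar>a P\<bar>)"
    by (rule sum.remove[OF finite_strings]) (simp add: strings_def)
  moreover have "(\<Sum>P\<in>strings n - {Map.empty}. \<bar>a P\<bar>) = (\<Sum>P\<in>S'. \<bar>a P\<bar>)"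
    by (rule sum.mono_neutral_right) (auto simp: S'_def S_def)
  moreover have "\<bar>a Map.empty\<bar> \<le> B"
    using c_empty by (simp add: c_def)
  ultimately show ?thesis
    by (simp add: algebra_simps power2_eq_square)
qed

section \<open>Expectations in product eigenstates and the spectral norm\<close>

lemma l2_norm_mult_vec_le:
  assumes v: "v \<in> carrier_vec (dim_col A)" "l2_norm v = 1"
  shows "l2_norm (A *\<^sub>v v) \<le> spectral_norm A"
  unfolding spectral_norm_def
proof (rule cSUP_upper)
  \<comment> \<open>The supremum dominates its members only when the set is bounded. The sum of all
    entry moduli is a crude bound, as unit vectors have entries of modulus at most 1.\<close>
  show "bdd_above ((\<lambda>v. l2_norm (A *\<^sub>v v)) ` {v \<in> carrier_vec (dim_col A). l2_norm v = 1})"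
  proof (rule bdd_aboveI2)
    fix v assume "v \<in> {v \<in> carrier_vec (dim_col A). l2_norm v = 1}"
    then have v: "dim_vec v = dim_col A" "l2_norm v = 1"
      by auto
    have entry: "cmod (v $ j) \<le> 1" if "j < dim_col A" for j
      using member_le_L2_set[of "{..<dim_vec v}" j "\<lambda>i. cmod (v $ i)"] v that
      by (simp add: l2_norm_def)
    have "l2_norm (A *\<^sub>v v) \<le> (\<Sum>i<dim_row A. cmod ((A *\<^sub>v v) $ i))"
      unfolding l2_norm_def dim_mult_mat_vec by (rule L2_set_le_sum) simp
    also have "\<dots> = (\<Sum>i<dim_row A. cmod (\<Sum>j<dim_col A. A $$ (i, j) * v $ j))"
      using v by (simp add: scalar_prod_def atLeast0LessThan)
    also have "\<dots> \<le> (\<Sum>i<dim_row A. \<Sum>j<dim_col A. cmod (A $$ (i, j)))"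
      by (intro sum_mono sum_norm_le) (auto simp: norm_mult entry mult_left_le)
    finally show "l2_norm (A *\<^sub>v v) \<le> (\<Sum>i<dim_row A. \<Sum>j<dim_col A. cmod (A $$ (i, j)))" .
  qed
qed (use v in auto)

lemma cmod_cscalar_prod_le:
  assumes "dim_vec v = dim_vec w"
  shows "cmod (v \<bullet>c w) \<le> l2_norm v * l2_norm w"
proof -
  have "cmod (v \<bullet>c w) \<le> (\<Sum>i<dim_vec w. \<bar>cmod (v $ i)\<bar> * \<bar>cmod (w $ i)\<bar>)"
    by (auto simp: scalar_prod_def atLeast0LessThan norm_mult intro!: sum_norm_le)
  also have "\<dots> \<le> l2_norm v * l2_norm w"
    using L2_set_mult_ineq[of "\<lambda>i. cmod (v $ i)" "\<lambda>i. cmod (w $ i)" "{..<dim_vec w}"] assms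
    by (simp add: l2_norm_def)
  finally show ?thesis .
qed

lemma sum_cmod_pauli_eigvec: "(\<Sum>x\<in>UNIV. (cmod (pauli_eigvec p s x))\<^sup>2) = 1"
  by (cases p; cases s) (auto simp: pauli_eigvec_def UNIV_bool norm_divide power_divide)

text \<open>The eigenprojector is the rank-one projection onto the product vector \<open>u\<close>,
  so the trace is the quadratic form of \<open>A\<close> at a unit vector, and Cauchy-Schwarz
  applies.\<close>

lemma cmod_trace_mult_eigenprojector_le:
  assumes A: "A \<in> carrier_mat (2 ^ n) (2 ^ n)"
  shows "cmod (mat_trace (A * eigenprojector n b s)) \<le> spectral_norm A"
proof -
  define u where "u r = (\<Prod>q<n. pauli_eigvec (b q) (s q) (bit r q))" for r :: nat
  let ?v = "vec (2 ^ n) u"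
  have "mat_trace (A * eigenprojector n b s) = (\<Sum>r<2^n. \<Sum>c<2^n. A $$ (r, c) * (u c * cnj (u r)))"
    unfolding eigenprojector_def
    by (simp add: mat_trace_mult[OF A tensor_carrier])
      (simp add: tensor_def pauli_projector_index prod.distrib u_def)
  also have "\<dots> = (A *\<^sub>v ?v) \<bullet>c ?v"
    using A by (simp add: scalar_prod_def atLeast0LessThan sum_distrib_right mult.assoc)
  finally have trace: "mat_trace (A * eigenprojector n b s) = (A *\<^sub>v ?v) \<bullet>c ?v" .
  have "(\<Sum>r<(2::nat)^n. (cmod (u r))\<^sup>2) = (\<Prod>q<n. \<Sum>x\<in>UNIV. (cmod (pauli_eigvec (b q) (s q) x))\<^sup>2)"
    unfolding u_def prod_norm[symmetric] prod_power_distrib by (rule sum_prod_bits)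
  then have norm: "l2_norm ?v = 1"
    by (simp add: l2_norm_def L2_set_def sum_cmod_pauli_eigvec)
  have "cmod ((A *\<^sub>v ?v) \<bullet>c ?v) \<le> l2_norm (A *\<^sub>v ?v) * l2_norm ?v"
    using A by (intro cmod_cscalar_prod_le) simp
  also have "\<dots> \<le> spectral_norm A"
    using A by (simp add: norm l2_norm_mult_vec_le)
  finally show ?thesis
    by (simp add: trace)
qed

section \<open>Pauli coefficients of sums of few-body observables\<close>

lemma pauli_coeff_mat_sum:
  assumes "\<And>j. j < J \<Longrightarrow> h j \<in> carrier_mat (2 ^ n) (2 ^ n)"
  shows "pauli_coeff n (mat_sum (2 ^ n) J h) P = (\<Sum>j<J. pauli_coeff n (h j) P)"
proof -
  have "mat_trace (mat_sum (2 ^ n) J h * pauli_string n P) =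
      (\<Sum>r<2^n. \<Sum>c<2^n. \<Sum>j<J. h j $$ (r, c) * pauli_string n P $$ (c, r))"
    by (subst mat_trace_mult[OF _ pauli_string_carrier])
      (auto simp: mat_sum_def sum_distrib_right)
  also have "\<dots> = (\<Sum>j<J. \<Sum>r<2^n. \<Sum>c<2^n. h j $$ (r, c) * pauli_string n P $$ (c, r))"
    by (simp only: sum.swap[of _ "{..<J}"])
  also have "\<dots> = (\<Sum>j<J. mat_trace (h j * pauli_string n P))"
    using assms by (intro sum.cong refl) (simp add: mat_trace_mult[OF _ pauli_string_carrier])
  finally show ?thesis
    by (simp add: pauli_coeff_def sum_divide_distrib)
qed

lemma dom_subset_qubit_support:
  assumes "P \<in> strings n" "pauli_coeff n A P \<noteq> 0"
  shows "dom P \<subseteq> qubit_support n A"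
proof
  fix q assume "q \<in> dom P"
  then show "q \<in> qubit_support n A"
    using assms trace_mult_pauli_string_eq_0[of n q A P]
    by (auto simp: qubit_support_def pauli_coeff_def strings_def)
qed

lemma card_dom_subset:
  assumes "finite A"
  shows "card {P :: nat \<Rightarrow> pauli option. dom P \<subseteq> A} = 4 ^ card A"
proof -
  have "{P :: nat \<Rightarrow> pauli option. dom P \<subseteq> A} = PiE_dflt A None (\<lambda>_. UNIV)"
    by (auto simp: PiE_dflt_def dom_def)
  moreover have "card (UNIV :: pauli option set) = 4"
    by (simp add: card_UNIV_option UNIV_pauli)
  ultimately show ?thesis
    using assms by (simp add: card_PiE_dflt)
qed

text \<open>A string with nonzero coefficient already has one in some term \<open>h j\<close>, so
  its support lies in that of the term. At most \<open>d\<close> terms involve \<open>q\<close>, and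
  each admits at most \<open>4 ^ k\<close> strings.\<close>

lemma sum_of_few_body_pauli_coeff:
  assumes "sum_of_few_body n k d A"
  shows "\<And>P. P \<in> strings n \<Longrightarrow> pauli_coeff n A P \<noteq> 0 \<Longrightarrow> card (dom P) \<le> k"
    and "\<And>q. q < n \<Longrightarrow> card {P \<in> strings n. pauli_coeff n A P \<noteq> 0 \<and> q \<in> dom P} \<le> d * 4 ^ k"
proof -
  obtain J h where h: "\<And>j. j < J \<Longrightarrow> observable n (h j)"
    and k: "\<And>j. j < J \<Longrightarrow> card (qubit_support n (h j)) \<le> k"
    and d: "\<And>q. q < n \<Longrightarrow> card {j. j < J \<and> q \<in> qubit_support n (h j)} \<le> d"
    and A: "A = mat_sum (2 ^ n) J h"
    using assms by (auto simp: sum_of_few_body_def)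
  have supp_fin: "finite (qubit_support n (h j))" for j
    by (simp add: qubit_support_def)
  have ex: "\<exists>j<J. dom P \<subseteq> qubit_support n (h j)"
    if "P \<in> strings n" "pauli_coeff n A P \<noteq> 0" for P
  proof -
    have "(\<Sum>j<J. pauli_coeff n (h j) P) \<noteq> 0"
      using that(2) h by (simp add: A pauli_coeff_mat_sum observable_def)
    then obtain j where "j < J" "pauli_coeff n (h j) P \<noteq> 0"
      by (auto elim: sum.not_neutral_contains_not_neutral)
    then show ?thesis
      using dom_subset_qubit_support[OF that(1)] by blast
  qed
  show "card (dom P) \<le> k" if "P \<in> strings n" "pauli_coeff n A P \<noteq> 0" for P
    using ex[OF that] k card_mono[OF supp_fin] by (meson order_trans)
  show "card {P \<in> strings n. pauli_coeff n A P \<noteq> 0 \<and> q \<in> dom P} \<le> d * 4 ^ k" if "q < n" for q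
  proof -
    let ?J = "{j. j < J \<and> q \<in> qubit_support n (h j)}"
    let ?U = "\<Union>j\<in>?J. {P :: nat \<Rightarrow> pauli option. dom P \<subseteq> qubit_support n (h j)}"
    have fin: "finite {P :: nat \<Rightarrow> pauli option. dom P \<subseteq> qubit_support n (h j)}" for j
      by (rule card_ge_0_finite) (simp add: card_dom_subset[OF supp_fin])
    have "card {P \<in> strings n. pauli_coeff n A P \<noteq> 0 \<and> q \<in> dom P} \<le> card ?U"
    proof (rule card_mono)
      show "{P \<in> strings n. pauli_coeff n A P \<noteq> 0 \<and> q \<in> dom P} \<subseteq> ?U"
        using ex by blast
    qed (use fin in auto)
    also have "\<dots> \<le> (\<Sum>j\<in>?J. card {P :: nat \<Rightarrow> pauli option. dom P \<subseteq> qubit_support n (h j)})"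
      by (intro card_UN_le) auto
    also have "\<dots> \<le> (\<Sum>j\<in>?J. 4 ^ k)"
      using k by (intro sum_mono) (simp add: card_dom_subset[OF supp_fin] power_increasing)
    also have "\<dots> \<le> d * 4 ^ k"
      using d[OF that] by simp
    finally show ?thesis .
  qed
qed

definition real_coeff :: "nat \<Rightarrow> complex mat \<Rightarrow> (nat \<Rightarrow> pauli option) \<Rightarrow> real" where
  "real_coeff n A P = Re (pauli_coeff n A P)"

lemma of_real_real_coeff:
  assumes "observable n A"
  shows "of_real (real_coeff n A P) = pauli_coeff n A P"
proof -
  have "mat_trace (A * pauli_string n P) \<in> \<real>"
    using assms by (intro trace_mult_pauli_string_real) (auto simp: observable_def)
  then have "pauli_coeff n A P \<in> \<real>"
    by (simp add: pauli_coeff_def)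
  then show ?thesis
    by (simp add: real_coeff_def of_real_Re)
qed

lemma real_coeff_eq_0_iff:
  assumes "observable n A"
  shows "real_coeff n A P = 0 \<longleftrightarrow> pauli_coeff n A P = 0"
  by (metis assms of_real_eq_0_iff of_real_real_coeff)

text \<open>The case \<open>m = d * 4 ^ k\<close> and \<open>B = spectral_norm A\<close>: the
  polynomial belonging to a basis is the expectation of \<open>A\<close> in its eigenstates.\<close>

lemma sum_abs_real_coeff_le_spectral_norm:
  assumes A: "observable n A" "sum_of_few_body n k d A"
  shows "(\<Sum>P\<in>strings n. \<bar>real_coeff n A P\<bar>) \<le> (2 * (real (k * (d * 4 ^ k)))\<^sup>2 + 3) * spectral_norm A"
proof (rule sum_abs_pauli_coeff_le)
  fix b s
  have carrier: "A \<in> carrier_mat (2 ^ n) (2 ^ n)"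
    using A(1) by (simp add: observable_def)
  have "complex_of_real (\<Sum>P\<in>strings n. real_coeff n A P * string_value n P b s) =
      mat_trace (A * eigenprojector n b s)"
    by (simp add: trace_mult_eigenprojector[OF carrier] of_real_real_coeff[OF A(1)])
  then have "\<bar>\<Sum>P\<in>strings n. real_coeff n A P * string_value n P b s\<bar> =
      cmod (mat_trace (A * eigenprojector n b s))"
    by (metis norm_of_real real_norm_def)
  then show "\<bar>\<Sum>P\<in>strings n. real_coeff n A P * string_value n P b s\<bar> \<le> spectral_norm A"
    using cmod_trace_mult_eigenprojector_le[OF carrier] by simp
qed (use sum_of_few_body_pauli_coeff[OF A(2)] in \<open>auto simp: real_coeff_eq_0_iff[OF A(1)]\<close>)

subsection \<open>Randomized Pauli measurements\<close>

text \<open>A uniformly random basis agrees with \<open>P\<close> on its support with probability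
  \<open>1 / 3 ^ card (dom P)\<close>; the prefactor compensates for this.\<close>

definition string_estimator ::
    "nat \<Rightarrow> (nat \<Rightarrow> pauli option) \<Rightarrow> (nat \<Rightarrow> pauli) \<times> (nat \<Rightarrow> bool) \<Rightarrow> real" where
  "string_estimator n P x = 3 ^ card (dom P) * string_value n P (fst x) (snd x)"

lemma abs_string_estimator_le:
  assumes "P \<in> strings n" "card (dom P) \<le> k"
  shows "\<bar>string_estimator n P x\<bar> \<le> 3 ^ k"
  using assms by (auto simp: string_estimator_def string_value_eq abs_mult intro: power_increasing)

text \<open>Unbiasedness on one qubit as a matrix identity. For the identity each basis contributes
  a complete pair of projectors with weight 1/3; for a Pauli matrix only its own basis counts, as
  the difference of its two projectors.\<close>

lemma sum_weighted_pauli_projector: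
  "(\<Sum>b\<in>UNIV. \<Sum>s\<in>UNIV. of_real (1 / 3 * (if p = None then 1 else 3) * pauli_value p b s) *
    pauli_projector b s $$ (of_bool x, of_bool y)) = local_pauli_mat p $$ (of_bool x, of_bool y)"
  by (cases p; cases "the p"; cases x; cases y)
    (auto simp: UNIV_bool UNIV_pauli pauli_value_def pauli_projector_def mat_of_rows_list_def)

text \<open>Weights and projectors are both products over the qubits, so the single-qubit identity
  tensorizes.\<close>

lemma sum_weighted_eigenprojector:
  assumes "P \<in> strings n" "r < 2 ^ n" "c < 2 ^ n"
  shows "(\<Sum>b\<in>PiE_dflt {..<n} undefined (\<lambda>_. UNIV). \<Sum>s\<in>outcomes n.
    of_real ((1 / 3) ^ n * string_estimator n P (b, s)) * eigenprojector n b s $$ (r, c)) =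
    pauli_string n P $$ (r, c)"
proof -
  let ?w = "\<lambda>p b s. 1 / 3 * (if p = None then 1 else 3) * pauli_value p b s"
  let ?g = "\<lambda>q b s. of_real (?w (P q) b s) *
      pauli_projector b s $$ (of_bool (bit r q), of_bool (bit c q)) :: complex"
  have "(3::real) ^ card (dom P) = (\<Prod>q\<in>{..<n} \<inter> dom P. 3)"
    using assms(1) by (simp add: strings_def Int_absorb1)
  also have "\<dots> = (\<Prod>q<n. if P q = None then 1 else 3)"
    by (subst prod.inter_restrict) (auto simp: domIff intro!: prod.cong)
  finally have card_dom: "(3::real) ^ card (dom P) = (\<Prod>q<n. if P q = None then 1 else 3)" .
  have weight: "(1 / 3) ^ n * string_estimator n P (b, s) = (\<Prod>q<n. ?w (P q) (b q) (s q))" for b s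
    by (simp only: string_estimator_def string_value_def fst_conv snd_conv prod.distrib prod_constant
        card_lessThan card_dom mult.assoc)
  have "(\<Sum>b\<in>PiE_dflt {..<n} undefined (\<lambda>_. UNIV). \<Sum>s\<in>outcomes n.
      of_real ((1 / 3) ^ n * string_estimator n P (b, s)) * eigenprojector n b s $$ (r, c)) =
      (\<Sum>b\<in>PiE_dflt {..<n} undefined (\<lambda>_. UNIV). \<Sum>s\<in>outcomes n. \<Prod>q<n. ?g q (b q) (s q))"
    unfolding weight eigenprojector_def tensor_def
    using assms(2,3) by (simp only: of_real_prod index_mat prod.case prod.distrib[symmetric])
  also have "\<dots> = (\<Sum>b\<in>PiE_dflt {..<n} undefined (\<lambda>_. UNIV). \<Prod>q<n. \<Sum>s\<in>UNIV. ?g q (b q) s)"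
    unfolding outcomes_def by (intro sum.cong refl sum_prod_PiE_dflt) auto
  also have "\<dots> = (\<Prod>q<n. \<Sum>b\<in>UNIV. \<Sum>s\<in>UNIV. ?g q b s)"
    by (rule sum_prod_PiE_dflt) auto
  also have "\<dots> = pauli_string n P $$ (r, c)"
    using assms by (simp only: sum_weighted_pauli_projector pauli_string_index)
  finally show ?thesis .
qed

lemma expectation_randomized_pauli_measurement:
  fixes f :: "(nat \<Rightarrow> pauli) \<times> (nat \<Rightarrow> bool) \<Rightarrow> real"
  assumes "quantum_state n \<rho>"
  shows "measure_pmf.expectation (randomized_pauli_measurement n \<rho>) f =
    (\<Sum>b\<in>PiE_dflt {..<n} undefined (\<lambda>_. UNIV). \<Sum>s\<in>outcomes n.
      (1 / 3) ^ n * Re (mat_trace (\<rho> * eigenprojector n b s)) * f (b, s))"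
proof -
  let ?G = "PiE_dflt {..<n} undefined (\<lambda>_. UNIV) :: (nat \<Rightarrow> pauli) set"
  let ?p = "Pi_pmf {..<n} undefined (\<lambda>_. pmf_of_set {PauliX, PauliY, PauliZ})"
  have set_outcome: "set_pmf (pauli_outcome n \<rho> b) \<subseteq> outcomes n" for b
    by (auto simp: set_pmf_eq pmf_pauli_outcome[OF assms] outcomes_eq)
  have "randomized_pauli_measurement n \<rho> = ?p \<bind> (\<lambda>b. map_pmf (Pair b) (pauli_outcome n \<rho> b))"
    by (simp add: randomized_pauli_measurement_def map_pmf_def)
  also have "measure_pmf.expectation \<dots> f =
      (\<Sum>b\<in>?G. pmf ?p b *\<^sub>R measure_pmf.expectation (map_pmf (Pair b) (pauli_outcome n \<rho> b)) f)"
  proof (rule pmf_expectation_bind)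
    show "finite ?G"
      by auto
    show "set_pmf ?p \<subseteq> ?G"
      by (auto simp: set_Pi_pmf PiE_dflt_def)
    show "finite (set_pmf (map_pmf (Pair b) (pauli_outcome n \<rho> b)))" for b
      using finite_subset[OF set_outcome] by simp
  qed
  also have "\<dots> = (\<Sum>b\<in>?G. (1 / 3) ^ n *\<^sub>R
      (\<Sum>s\<in>outcomes n. Re (mat_trace (\<rho> * eigenprojector n b s)) *\<^sub>R f (b, s)))"
  proof (intro sum.cong refl arg_cong2[where f = scaleR])
    fix b assume b: "b \<in> ?G"
    have "pmf (pmf_of_set {PauliX, PauliY, PauliZ}) x = 1 / 3" for x
      by (cases x) auto
    with b show "pmf ?p b = (1 / 3) ^ n"
      by (subst pmf_Pi') (auto simp: PiE_dflt_def power_one_over)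
    have "measure_pmf.expectation (pauli_outcome n \<rho> b) (\<lambda>s. f (b, s)) =
        (\<Sum>s\<in>outcomes n. pmf (pauli_outcome n \<rho> b) s *\<^sub>R f (b, s))"
      using set_outcome[of b] by (intro integral_measure_pmf) auto
    also have "\<dots> = (\<Sum>s\<in>outcomes n. Re (mat_trace (\<rho> * eigenprojector n b s)) *\<^sub>R f (b, s))"
      by (intro sum.cong refl) (simp add: pmf_pauli_outcome[OF assms] outcomes_eq eigenprojector_def)
    finally show "measure_pmf.expectation (map_pmf (Pair b) (pauli_outcome n \<rho> b)) f =
        (\<Sum>s\<in>outcomes n. Re (mat_trace (\<rho> * eigenprojector n b s)) *\<^sub>R f (b, s))"
      by simp
  qed
  finally show ?thesis
    by (simp add: sum_distrib_left mult.assoc)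
qed

text \<open>The Born rule is linear in the projector, so the average over bases and outcomes can be
  taken inside the trace.\<close>

lemma expectation_string_estimator:
  assumes \<rho>: "quantum_state n \<rho>" and P: "P \<in> strings n"
  shows "measure_pmf.expectation (randomized_pauli_measurement n \<rho>) (string_estimator n P) =
    Re (mat_trace (\<rho> * pauli_string n P))"
proof -
  let ?G = "PiE_dflt {..<n} undefined (\<lambda>_. UNIV) :: (nat \<Rightarrow> pauli) set"
  let ?w = "\<lambda>b s. complex_of_real ((1 / 3) ^ n * string_estimator n P (b, s))"
  have carrier: "\<rho> \<in> carrier_mat (2 ^ n) (2 ^ n)"
    using \<rho> by (simp add: quantum_state_def)
  have carrier': "eigenprojector n b s \<in> carrier_mat (2 ^ n) (2 ^ n)" for b s
    by (simp add: eigenprojector_def tensor_carrier)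
  have "(\<Sum>b\<in>?G. \<Sum>s\<in>outcomes n. ?w b s * mat_trace (\<rho> * eigenprojector n b s)) =
      (\<Sum>b\<in>?G. \<Sum>s\<in>outcomes n. \<Sum>r<2^n. \<Sum>c<2^n.
        \<rho> $$ (r, c) * (?w b s * eigenprojector n b s $$ (c, r)))"
    by (simp only: mat_trace_mult[OF carrier carrier'] sum_distrib_left mult.left_commute)
  also have "\<dots> = (\<Sum>r<2^n. \<Sum>c<2^n. \<Sum>b\<in>?G. \<Sum>s\<in>outcomes n.
        \<rho> $$ (r, c) * (?w b s * eigenprojector n b s $$ (c, r)))"
    by (simp only: sum.swap[of _ "{..<2 ^ n}" "outcomes n"] sum.swap[of _ "{..<2 ^ n}" ?G])
  also have "\<dots> = (\<Sum>r<2^n. \<Sum>c<2^n. \<rho> $$ (r, c) *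
        (\<Sum>b\<in>?G. \<Sum>s\<in>outcomes n. ?w b s * eigenprojector n b s $$ (c, r)))"
    by (simp only: sum_distrib_left)
  also have "\<dots> = (\<Sum>r<2^n. \<Sum>c<2^n. \<rho> $$ (r, c) * pauli_string n P $$ (c, r))"
    using sum_weighted_eigenprojector[OF P] by (intro sum.cong refl) simp
  also have "\<dots> = mat_trace (\<rho> * pauli_string n P)"
    by (simp add: mat_trace_mult[OF carrier pauli_string_carrier])
  finally have "Re (mat_trace (\<rho> * pauli_string n P)) =
      Re (\<Sum>b\<in>?G. \<Sum>s\<in>outcomes n. ?w b s * mat_trace (\<rho> * eigenprojector n b s))"
    by (simp only:)
  also have "\<dots> = (\<Sum>b\<in>?G. \<Sum>s\<in>outcomes n. Re (?w b s * mat_trace (\<rho> * eigenprojector n b s)))"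
    by (simp only: Re_sum)
  also have "\<dots> = measure_pmf.expectation (randomized_pauli_measurement n \<rho>) (string_estimator n P)"
    unfolding expectation_randomized_pauli_measurement[OF \<rho>]
    by (intro sum.cong refl) (simp only: Re_complex_of_real Im_complex_of_real times_complex.sel, simp)
  finally show ?thesis
    by simp
qed

lemma trace_mult_eq_sum_expectation:
  assumes \<rho>: "quantum_state n \<rho>" and A: "observable n A"
  shows "mat_trace (A * \<rho>) = of_real (\<Sum>P\<in>strings n. real_coeff n A P *
    measure_pmf.expectation (randomized_pauli_measurement n \<rho>) (string_estimator n P))"
proof -
  have "mat_trace (\<rho> * pauli_string n P) \<in> \<real>" for P
    using \<rho> by (intro trace_mult_pauli_string_real) (auto simp: quantum_state_def)
  then have "mat_trace (\<rho> * pauli_string n P) = of_real (measure_pmf.expectation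
      (randomized_pauli_measurement n \<rho>) (string_estimator n P))" if "P \<in> strings n" for P
    using that by (simp add: expectation_string_estimator[OF \<rho>] of_real_Re)
  moreover have "mat_trace (A * \<rho>) =
      (\<Sum>P\<in>strings n. pauli_coeff n A P * mat_trace (\<rho> * pauli_string n P))"
    using \<rho> A by (intro trace_mult_eq_sum_pauli) (auto simp: quantum_state_def observable_def)
  ultimately show ?thesis
    by (simp add: of_real_real_coeff[OF A])
qed

section \<open>Concentration of sample means and counting of strings\<close>

definition sample_mean :: "nat \<Rightarrow> ('a \<Rightarrow> real) \<Rightarrow> (nat \<Rightarrow> 'a) \<Rightarrow> real" where
  "sample_mean N f \<omega> = (\<Sum>t<N. f (\<omega> t)) / real N"

lemma prob_sample_mean_deviation:
  fixes f :: "'a \<Rightarrow> real"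
  assumes f: "\<And>x. \<bar>f x\<bar> \<le> c" and "0 < c" "0 < N" "0 \<le> \<eta>"
  shows "measure_pmf.prob (Pi_pmf {..<N} dflt (\<lambda>_. p))
    {\<omega>. \<bar>sample_mean N f \<omega> - measure_pmf.expectation p f\<bar> \<ge> \<eta>} \<le>
    2 * exp (- (real N * \<eta>\<^sup>2 / (2 * c\<^sup>2)))"
proof -
  let ?M = "Pi_pmf {..<N} dflt (\<lambda>_. p)"
  let ?X = "\<lambda>t \<omega>. f (\<omega> t)"
  have expect: "measure_pmf.expectation ?M (?X t) = measure_pmf.expectation p f" if "t < N" for t
  proof -
    have "measure_pmf.expectation ?M (?X t) = measure_pmf.expectation (map_pmf (\<lambda>\<omega>. \<omega> t) ?M) f"
      by simp
    also have "map_pmf (\<lambda>\<omega>. \<omega> t) ?M = p"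
      using that by (simp add: Pi_pmf_component)
    finally show ?thesis .
  qed
  interpret Hoeffding_ineq "measure_pmf ?M" "{..<N}" ?X "\<lambda>_. - c" "\<lambda>_. c"
    "\<Sum>t<N. measure_pmf.expectation ?M (?X t)"
  proof unfold_locales
    show "prob_space.indep_vars ?M (\<lambda>_. borel) ?X {..<N}"
      by (rule prob_space.indep_vars_compose2[OF measure_pmf.prob_space_axioms indep_vars_Pi_pmf]) auto
    show "AE \<omega> in measure_pmf ?M. ?X t \<omega> \<in> {- c..c}" for t
      using f by (intro AE_pmfI) (auto simp: abs_le_iff minus_le_iff)
  qed auto
  have "{\<omega>. \<bar>sample_mean N f \<omega> - measure_pmf.expectation p f\<bar> \<ge> \<eta>} =
      {\<omega> \<in> space ?M. \<bar>(\<Sum>t<N. ?X t \<omega>) - (\<Sum>t<N. measure_pmf.expectation ?M (?X t))\<bar> \<ge> real N * \<eta>}"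
  proof -
    have "real N * \<eta> \<le> \<bar>a - real N * e\<bar> \<longleftrightarrow> \<eta> \<le> \<bar>a / real N - e\<bar>" for a e :: real
    proof -
      have "\<bar>a - real N * e\<bar> = real N * \<bar>a / real N - e\<bar>"
        using \<open>0 < N\<close> by (simp add: abs_mult_pos field_simps flip: abs_mult_pos')
      then show ?thesis
        using \<open>0 < N\<close> by simp
    qed
    then show ?thesis
      by (simp add: sample_mean_def expect)
  qed
  \<comment> \<open>Each summand lies in an interval of length \<open>2 * c\<close>, so the
    denominator is \<open>4 * N * c\<^sup>2\<close>.\<close>
  also have "measure_pmf.prob ?M \<dots> \<le> 2 * exp (- 2 * (real N * \<eta>)\<^sup>2 / (\<Sum>t<N. (c - - c)\<^sup>2))"
    using assms by (intro Hoeffding_ineq_abs_ge) auto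
  also have "- 2 * (real N * \<eta>)\<^sup>2 / (\<Sum>t<N. (c - - c)\<^sup>2) = - (real N * \<eta>\<^sup>2 / (2 * c\<^sup>2))"
    using assms by (simp add: field_simps power2_eq_square)
  finally show ?thesis .
qed

lemma prob_all_sample_means_close:
  fixes f :: "'i \<Rightarrow> 'a \<Rightarrow> real"
  assumes "finite I" "\<And>i x. i \<in> I \<Longrightarrow> \<bar>f i x\<bar> \<le> c" "0 < c" "0 < N" "0 \<le> \<eta>"
  shows "measure_pmf.prob (Pi_pmf {..<N} dflt (\<lambda>_. p))
    {\<omega>. \<forall>i\<in>I. \<bar>sample_mean N (f i) \<omega> - measure_pmf.expectation p (f i)\<bar> \<le> \<eta>} \<ge>
    1 - 2 * real (card I) * exp (- (real N * \<eta>\<^sup>2 / (2 * c\<^sup>2)))"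
proof -
  let ?M = "Pi_pmf {..<N} dflt (\<lambda>_. p)"
  let ?bad = "\<lambda>i. {\<omega>. \<bar>sample_mean N (f i) \<omega> - measure_pmf.expectation p (f i)\<bar> \<ge> \<eta>}"
  have "measure_pmf.prob ?M (\<Union>i\<in>I. ?bad i) \<le> (\<Sum>i\<in>I. measure_pmf.prob ?M (?bad i))"
    using assms(1) by (intro measure_pmf.finite_measure_subadditive_finite) auto
  also have "\<dots> \<le> (\<Sum>i\<in>I. 2 * exp (- (real N * \<eta>\<^sup>2 / (2 * c\<^sup>2))))"
    using assms by (intro sum_mono prob_sample_mean_deviation) auto
  finally have "1 - 2 * real (card I) * exp (- (real N * \<eta>\<^sup>2 / (2 * c\<^sup>2))) \<le>
      1 - measure_pmf.prob ?M (\<Union>i\<in>I. ?bad i)"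
    by (simp add: mult_ac)
  also have "\<dots> = measure_pmf.prob ?M (- (\<Union>i\<in>I. ?bad i))"
    using measure_pmf.prob_compl[of "\<Union>i\<in>I. ?bad i" ?M] by (simp add: Compl_eq_Diff_UNIV)
  also have "\<dots> \<le> measure_pmf.prob ?M
      {\<omega>. \<forall>i\<in>I. \<bar>sample_mean N (f i) \<omega> - measure_pmf.expectation p (f i)\<bar> \<le> \<eta>}"
    by (intro measure_pmf.finite_measure_mono) (auto simp: not_le intro: less_imp_le)
  finally show ?thesis .
qed

text \<open>A nonempty string arises from one of smaller weight by setting one qubit to one of four
  values, a factor \<open>4 * n\<close> per step.\<close>

lemma card_low_weight_strings:
  assumes "1 \<le> n"
  shows "card {P \<in> strings n. card (dom P) \<le> k} \<le> (4 * n) ^ k"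
proof (induction k)
  case 0
  have "P = Map.empty" if "P \<in> strings n" "card (dom P) = 0" for P
    using that finite_subset[of "dom P" "{..<n}"] by (auto simp: strings_def)
  then have "{P \<in> strings n. card (dom P) \<le> 0} \<subseteq> {Map.empty}"
    by auto
  then have "card {P \<in> strings n. card (dom P) \<le> 0} \<le> card {Map.empty :: nat \<Rightarrow> pauli option}"
    by (intro card_mono) auto
  then show ?case
    by simp
next
  case (Suc k)
  let ?S = "\<lambda>k. {P \<in> strings n. card (dom P) \<le> k}"
  let ?upd = "\<lambda>(P, q, p). P(q := p) :: nat \<Rightarrow> pauli option"
  have "?S (Suc k) \<subseteq> ?upd ` (?S k \<times> {..<n} \<times> UNIV)"
  proof
    fix P assume P: "P \<in> ?S (Suc k)"
    then have fin: "finite (dom P)"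
      by (auto simp: strings_def intro: finite_subset)
    show "P \<in> ?upd ` (?S k \<times> {..<n} \<times> UNIV)"
    proof (cases "dom P = {}")
      case True
      then show ?thesis
        \<comment> \<open>The empty string is its own preimage, with qubit 0 overwritten by
          \<open>None\<close>; qubit 0 exists since \<open>1 \<le> n\<close>.\<close>
        using assms P by (intro image_eqI[of _ _ "(P, 0, P 0)"]) auto
    next
      case False
      then obtain q where q: "q \<in> dom P"
        by auto
      then have "card (dom P - {q}) \<le> k" "q < n"
        using P fin by (auto simp: card_Diff_singleton strings_def)
      then show ?thesis
        using P by (intro image_eqI[of _ _ "(P(q := None), q, P q)"]) (auto simp: strings_def)
    qed
  qed
  then have "card (?S (Suc k)) \<le> card (?S k \<times> {..<n} \<times> (UNIV :: pauli option set))"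
    by (intro surj_card_le) auto
  also have "\<dots> = card (?S k) * (4 * n)"
    by (simp add: card_cartesian_product card_UNIV_option UNIV_pauli)
  also have "\<dots> \<le> (4 * n) ^ k * (4 * n)"
    using Suc by (intro mult_right_mono) auto
  finally show ?case
    by (simp add: mult.commute)
qed

text \<open>\<open>L\<close> is the number of events in a union bound and \<open>u\<close> the
  Hoeffding exponent.\<close>

lemma union_bound_le:
  assumes "L \<le> exp l" "0 < \<delta>" "ln (2 / \<delta>) + l \<le> u"
  shows "2 * L * exp (- u) \<le> (\<delta> :: real)"
proof -
  have "2 * L * exp (- u) \<le> 2 * exp l * exp (- (ln (2 / \<delta>) + l))"
    using assms by (intro mult_mono[of "2 * L"]) auto
  also have "\<dots> = \<delta>"
    using assms(2) by (simp add: exp_minus exp_diff exp_ln field_simps)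
  finally show ?thesis .
qed

lemma sample_mean_sum:
  "sample_mean N (\<lambda>x. \<Sum>i\<in>I. a i * f i x) \<omega> = (\<Sum>i\<in>I. a i * sample_mean N (f i) \<omega>)"
  unfolding sample_mean_def
  by (subst sum.swap) (simp add: sum_distrib_left sum_divide_distrib mult.assoc)

text \<open>Finite support makes every real function of the outcome integrable.\<close>

lemma finite_set_randomized_pauli_measurement:
  assumes "quantum_state n \<rho>"
  shows "finite (set_pmf (randomized_pauli_measurement n \<rho>))"
proof -
  have "set_pmf (pauli_outcome n \<rho> b) \<subseteq> outcomes n" for b
    by (auto simp: set_pmf_eq pmf_pauli_outcome[OF assms] outcomes_eq)
  then have "finite (set_pmf (pauli_outcome n \<rho> b))" for b
    by (rule finite_subset) simp
  moreover have "finite (set_pmf (Pi_pmf {..<n} undefined (\<lambda>_. pmf_of_set {PauliX, PauliY, PauliZ})))"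
    by (auto simp: set_Pi_pmf)
  ultimately show ?thesis
    by (simp add: randomized_pauli_measurement_def)
qed

section \<open>Simultaneous estimation of all observables\<close>

definition low_weight_strings :: "nat \<Rightarrow> nat \<Rightarrow> (nat \<Rightarrow> pauli option) set" where
  "low_weight_strings n k = {P \<in> strings n. card (dom P) \<le> k}"

text \<open>For \<open>M \<le> n\<close> the deviations of whole observables are controlled, each
  single-run estimate being at most \<open>3 ^ k * Z\<close> in modulus; otherwise every string of
  low weight is estimated to accuracy \<open>\<epsilon> / Z\<close>, and the coefficient sum
  \<open>Z\<close> restores \<open>\<epsilon>\<close>.\<close>

lemma observable_estimation:
  fixes Ob :: "nat \<Rightarrow> complex mat"
  assumes "1 \<le> n" "1 \<le> M" "0 < \<epsilon>" "0 < \<delta>" "0 < N"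
    and Ob: "\<And>i. i < M \<Longrightarrow> observable n (Ob i)"
    and low: "\<And>i P. i < M \<Longrightarrow> P \<in> strings n \<Longrightarrow> real_coeff n (Ob i) P \<noteq> 0 \<Longrightarrow> card (dom P) \<le> k"
    and coeff: "\<And>i. i < M \<Longrightarrow> (\<Sum>P\<in>strings n. \<bar>real_coeff n (Ob i) P\<bar>) \<le> Z"
    and "0 < Z"
    and N: "ln (2 / \<delta>) + (4 * real k + 1) * max 1 (ln (real (min M n))) \<le>
      real N * \<epsilon>\<^sup>2 / (2 * (3 ^ k * Z)\<^sup>2)"
    and \<rho>: "quantum_state n \<rho>"
  shows "1 - \<delta> \<le> measure_pmf.prob (randomized_pauli_measurements N n \<rho>)
    {\<omega>. \<forall>i<M. cmod (complex_of_real
      (\<Sum>P\<in>strings n. real_coeff n (Ob i) P * sample_mean N (string_estimator n P) \<omega>) -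
      mat_trace (Ob i * \<rho>)) \<le> \<epsilon>}" (is "_ \<le> measure_pmf.prob _ ?good")
proof -
  let ?\<mu> = "randomized_pauli_measurement n \<rho>"
  let ?E = "\<lambda>P. measure_pmf.expectation ?\<mu> (string_estimator n P)"
  let ?L = "max 1 (ln (real (min M n)))"
  have error: "cmod (complex_of_real
      (\<Sum>P\<in>strings n. real_coeff n (Ob i) P * sample_mean N (string_estimator n P) \<omega>) -
      mat_trace (Ob i * \<rho>)) =
      \<bar>\<Sum>P\<in>strings n. real_coeff n (Ob i) P * (sample_mean N (string_estimator n P) \<omega> - ?E P)\<bar>"
    if "i < M" for i \<omega>
    unfolding trace_mult_eq_sum_expectation[OF \<rho> Ob[OF that]] of_real_diff[symmetric] norm_of_real
    by (simp only: sum_subtractf right_diff_distrib)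
  have integrable: "integrable ?\<mu> f" for f :: "(nat \<Rightarrow> pauli) \<times> (nat \<Rightarrow> bool) \<Rightarrow> real"
    by (intro integrable_measure_pmf_finite finite_set_randomized_pauli_measurement \<rho>)
  show ?thesis
  proof (cases "M \<le> n")
    case True
    define Y where "Y i x = (\<Sum>P\<in>strings n. real_coeff n (Ob i) P * string_estimator n P x)" for i x
    have Y: "\<bar>Y i x\<bar> \<le> 3 ^ k * Z" if "i < M" for i x
    proof -
      have "\<bar>Y i x\<bar> \<le> (\<Sum>P\<in>strings n. \<bar>real_coeff n (Ob i) P * string_estimator n P x\<bar>)"
        unfolding Y_def by (rule sum_abs)
      also have "\<dots> \<le> (\<Sum>P\<in>strings n. 3 ^ k * \<bar>real_coeff n (Ob i) P\<bar>)"
      proof (rule sum_mono)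
        fix P assume P: "P \<in> strings n"
        show "\<bar>real_coeff n (Ob i) P * string_estimator n P x\<bar> \<le> 3 ^ k * \<bar>real_coeff n (Ob i) P\<bar>"
        proof (cases "real_coeff n (Ob i) P = 0")
          case False
          then show ?thesis
            using abs_string_estimator_le[OF P low[OF that P False], of x]
            by (simp add: abs_mult mult.commute)
        qed simp
      qed
      also have "\<dots> \<le> 3 ^ k * Z"
        using coeff[OF that] by (simp flip: sum_distrib_left)
      finally show ?thesis .
    qed
    have "real M \<le> exp ((4 * real k + 1) * ?L)"
    proof -
      have "ln (real M) \<le> ?L"
        using True by simp
      also have "\<dots> \<le> (4 * real k + 1) * ?L"
        by (simp add: distrib_right)
      finally have "exp (ln (real M)) \<le> exp ((4 * real k + 1) * ?L)"
        by (simp only: exp_le_cancel_iff)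
      then show ?thesis
        using \<open>1 \<le> M\<close> by simp
    qed
    then have "2 * real (card {..<M}) * exp (- (real N * \<epsilon>\<^sup>2 / (2 * (3 ^ k * Z)\<^sup>2))) \<le> \<delta>"
      using N \<open>0 < \<delta>\<close> by (intro union_bound_le) auto
    then have "1 - \<delta> \<le> 1 - 2 * real (card {..<M}) * exp (- (real N * \<epsilon>\<^sup>2 / (2 * (3 ^ k * Z)\<^sup>2)))"
      by simp
    also have "\<dots> \<le> measure_pmf.prob (randomized_pauli_measurements N n \<rho>)
        {\<omega>. \<forall>i\<in>{..<M}. \<bar>sample_mean N (Y i) \<omega> - measure_pmf.expectation ?\<mu> (Y i)\<bar> \<le> \<epsilon>}"
      unfolding randomized_pauli_measurements_def
      using Y assms by (intro prob_all_sample_means_close) auto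
    also have "\<dots> \<le> measure_pmf.prob (randomized_pauli_measurements N n \<rho>) ?good"
    proof (intro measure_pmf.finite_measure_mono subsetI CollectI allI impI)
      fix \<omega> i
      assume "\<omega> \<in> {\<omega>. \<forall>i\<in>{..<M}. \<bar>sample_mean N (Y i) \<omega> - measure_pmf.expectation ?\<mu> (Y i)\<bar> \<le> \<epsilon>}"
        and i: "i < M"
      then have "\<bar>sample_mean N (Y i) \<omega> - measure_pmf.expectation ?\<mu> (Y i)\<bar> \<le> \<epsilon>"
        by simp
      moreover have "measure_pmf.expectation ?\<mu> (Y i) = (\<Sum>P\<in>strings n. real_coeff n (Ob i) P * ?E P)"
        unfolding Y_def by (simp add: integrable)
      moreover have "sample_mean N (Y i) \<omega> =
          (\<Sum>P\<in>strings n. real_coeff n (Ob i) P * sample_mean N (string_estimator n P) \<omega>)"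
        unfolding Y_def by (rule sample_mean_sum)
      ultimately show "cmod (complex_of_real
          (\<Sum>P\<in>strings n. real_coeff n (Ob i) P * sample_mean N (string_estimator n P) \<omega>) -
          mat_trace (Ob i * \<rho>)) \<le> \<epsilon>"
        by (simp only: error[OF i] sum_subtractf right_diff_distrib)
    qed simp
    finally show ?thesis .
  next
    case False
    let ?I = "low_weight_strings n k"
    have "real (card ?I) \<le> real ((4 * n) ^ k)"
      unfolding of_nat_le_iff low_weight_strings_def by (rule card_low_weight_strings) fact
    also have "\<dots> = (4 * real n) ^ k"
      by simp
    also have "\<dots> \<le> exp (4 * ?L) ^ k"
    proof (rule power_mono)
      \<comment> \<open>\<open>4 \<le> exp 3\<close> follows from \<open>1 + x \<le> exp x\<close>.
        As \<open>min M n = n\<close> here, \<open>3 + ln (real n)\<close> is at most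
        \<open>4 * ?L\<close>.\<close>
      have "4 * real n \<le> exp 3 * exp (ln (real n))"
        using exp_ge_add_one_self[of 3] \<open>1 \<le> n\<close> by (intro mult_mono) auto
      also have "\<dots> \<le> exp (4 * ?L)"
        using False by (simp flip: exp_add)
      finally show "4 * real n \<le> exp (4 * ?L)" .
    qed simp
    also have "\<dots> = exp (4 * real k * ?L)"
      by (simp add: mult_ac flip: exp_of_nat_mult)
    also have "\<dots> \<le> exp ((4 * real k + 1) * ?L)"
      by (simp add: distrib_right)
    finally have "2 * real (card ?I) * exp (- (real N * \<epsilon>\<^sup>2 / (2 * (3 ^ k * Z)\<^sup>2))) \<le> \<delta>"
      using N \<open>0 < \<delta>\<close> by (intro union_bound_le) auto
    \<comment> \<open>Compared with the other case, accuracy and range are both divided by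
      \<open>Z\<close>, which leaves the exponent unchanged.\<close>
    moreover have "real N * (\<epsilon> / Z)\<^sup>2 / (2 * (3 ^ k)\<^sup>2) = real N * \<epsilon>\<^sup>2 / (2 * (3 ^ k * Z)\<^sup>2)"
      by (simp add: power_divide power_mult_distrib)
    ultimately have "1 - \<delta> \<le> 1 - 2 * real (card ?I) * exp (- (real N * (\<epsilon> / Z)\<^sup>2 / (2 * (3 ^ k)\<^sup>2)))"
      by simp
    also have "\<dots> \<le> measure_pmf.prob (randomized_pauli_measurements N n \<rho>)
        {\<omega>. \<forall>P\<in>?I. \<bar>sample_mean N (string_estimator n P) \<omega> - ?E P\<bar> \<le> \<epsilon> / Z}"
      unfolding randomized_pauli_measurements_def
      using assms by (intro prob_all_sample_means_close)
        (auto simp: low_weight_strings_def intro: abs_string_estimator_le)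
    also have "\<dots> \<le> measure_pmf.prob (randomized_pauli_measurements N n \<rho>) ?good"
    proof (intro measure_pmf.finite_measure_mono subsetI CollectI allI impI)
      fix \<omega> i
      assume \<omega>: "\<omega> \<in> {\<omega>. \<forall>P\<in>?I. \<bar>sample_mean N (string_estimator n P) \<omega> - ?E P\<bar> \<le> \<epsilon> / Z}"
        and i: "i < M"
      let ?d = "\<lambda>P. sample_mean N (string_estimator n P) \<omega> - ?E P"
      have "\<bar>\<Sum>P\<in>strings n. real_coeff n (Ob i) P * ?d P\<bar> \<le>
          (\<Sum>P\<in>strings n. \<bar>real_coeff n (Ob i) P\<bar> * \<bar>?d P\<bar>)"
        by (rule order_trans[OF sum_abs]) (simp add: abs_mult)
      also have "\<dots> \<le> (\<Sum>P\<in>strings n. \<bar>real_coeff n (Ob i) P\<bar> * (\<epsilon> / Z))"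
      proof (rule sum_mono)
        fix P assume P: "P \<in> strings n"
        show "\<bar>real_coeff n (Ob i) P\<bar> * \<bar>?d P\<bar> \<le> \<bar>real_coeff n (Ob i) P\<bar> * (\<epsilon> / Z)"
        proof (cases "real_coeff n (Ob i) P = 0")
          case False
          then have "P \<in> ?I"
            using low[OF i P] P by (simp add: low_weight_strings_def)
          then show ?thesis
            using \<omega> by (intro mult_left_mono) auto
        qed simp
      qed
      also have "\<dots> \<le> Z * (\<epsilon> / Z)"
        unfolding sum_distrib_right[symmetric] using coeff[OF i] \<open>0 < Z\<close> \<open>0 < \<epsilon>\<close>
        by (intro mult_right_mono) auto
      finally show "cmod (complex_of_real
          (\<Sum>P\<in>strings n. real_coeff n (Ob i) P * sample_mean N (string_estimator n P) \<omega>) -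
          mat_trace (Ob i * \<rho>)) \<le> \<epsilon>"
        unfolding error[OF i] using \<open>0 < Z\<close> by simp
    qed simp
    finally show ?thesis .
  qed
qed

text \<open>Serves the case without measurements: the expectation of each string is the mean of an
  estimator bounded by \<open>3 ^ k\<close>.\<close>

lemma cmod_trace_mult_le_sum_coeff:
  assumes \<rho>: "quantum_state n \<rho>" and A: "observable n A"
    and low: "\<And>P. P \<in> strings n \<Longrightarrow> real_coeff n A P \<noteq> 0 \<Longrightarrow> card (dom P) \<le> k"
  shows "cmod (mat_trace (A * \<rho>)) \<le> 3 ^ k * (\<Sum>P\<in>strings n. \<bar>real_coeff n A P\<bar>)"
proof -
  let ?E = "\<lambda>P. measure_pmf.expectation (randomized_pauli_measurement n \<rho>) (string_estimator n P)"
  have E: "\<bar>?E P\<bar> \<le> 3 ^ k" if "P \<in> strings n" "card (dom P) \<le> k" for P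
  proof -
    have "\<bar>?E P\<bar> \<le> measure_pmf.expectation (randomized_pauli_measurement n \<rho>) (\<lambda>x. \<bar>string_estimator n P x\<bar>)"
      by (rule integral_abs_bound)
    also have "\<dots> \<le> 3 ^ k"
      using abs_string_estimator_le[OF that] \<rho>
      by (intro measure_pmf.integral_le_const integrable_measure_pmf_finite
          finite_set_randomized_pauli_measurement AE_pmfI)
    finally show ?thesis .
  qed
  have "cmod (mat_trace (A * \<rho>)) \<le> (\<Sum>P\<in>strings n. \<bar>real_coeff n A P * ?E P\<bar>)"
    unfolding trace_mult_eq_sum_expectation[OF \<rho> A] norm_of_real by (rule sum_abs)
  also have "\<dots> \<le> (\<Sum>P\<in>strings n. 3 ^ k * \<bar>real_coeff n A P\<bar>)"
  proof (rule sum_mono)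
    fix P assume P: "P \<in> strings n"
    show "\<bar>real_coeff n A P * ?E P\<bar> \<le> 3 ^ k * \<bar>real_coeff n A P\<bar>"
    proof (cases "real_coeff n A P = 0")
      case False
      then show ?thesis
        using E[OF P low[OF P False]] by (simp add: abs_mult mult.commute)
    qed simp
  qed
  finally show ?thesis
    by (simp add: sum_distrib_left)
qed

text \<open>\<open>C\<close> depends on \<open>k\<close>, \<open>d\<close> and
  \<open>\<delta>\<close> only. The \<open>max 1\<close> keeps the logarithmic factor from vanishing
  at \<open>min M n = 1\<close>. The estimator is fixed before the state.\<close>

theorem theorem11:
  fixes k d :: nat and \<delta> :: real
  assumes "0 < \<delta>" and "\<delta> < 1"
  shows "\<exists>C>0. \<forall>(n::nat) (M::nat) (Ob :: nat \<Rightarrow> complex mat) (\<epsilon>::real).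
    1 \<le> n \<longrightarrow> 1 \<le> M \<longrightarrow> 0 < \<epsilon> \<longrightarrow>
    (\<forall>i<M. observable n (Ob i) \<and> sum_of_few_body n k d (Ob i)) \<longrightarrow>
    (\<exists>N\<^sub>0::nat.
       real N\<^sub>0 \<le> C * (max 1 (ln (real (min M n))) * (MAX i\<in>{..<M}. spectral_norm (Ob i))\<^sup>2 / \<epsilon>\<^sup>2) \<and>
       (\<forall>N\<ge>N\<^sub>0.
          \<exists>est :: (nat \<Rightarrow> (nat \<Rightarrow> pauli) \<times> (nat \<Rightarrow> bool)) \<Rightarrow> nat \<Rightarrow> real.
            \<forall>\<rho>. quantum_state n \<rho> \<longrightarrow>
              measure_pmf.prob (randomized_pauli_measurements N n \<rho>)
                {\<omega>. \<forall>i<M. cmod (complex_of_real (est \<omega> i) - mat_trace (Ob i * \<rho>)) \<le> \<epsilon>} \<ge> 1 - \<delta>))"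
proof -
  define K :: real where "K = 2 * (real (k * (d * 4 ^ k)))\<^sup>2 + 3"
  \<comment> \<open>Since the logarithmic factor \<open>L\<close> is at least 1,
    \<open>c * L\<close> dominates \<open>ln (2 / \<delta>) + (4 * real k + 1) * L\<close>.\<close>
  define c where "c = ln (2 / \<delta>) + (4 * real k + 1)"
  have "0 < K"
    unfolding K_def by (intro add_nonneg_pos) auto
  have "0 < ln (2 / \<delta>)"
    using assms by simp
  then have "1 \<le> c"
    by (simp add: c_def)
  show ?thesis
  \<comment> \<open>The factor 4 is the 2 of the Hoeffding exponent times another 2 for rounding the
    number of runs up.\<close>
  proof (intro exI[of _ "4 * c * (3 ^ k * K)\<^sup>2"] conjI allI impI)
    show "0 < 4 * c * (3 ^ k * K)\<^sup>2"
      using \<open>1 \<le> c\<close> \<open>0 < K\<close> by simp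
    fix n M :: nat and Ob :: "nat \<Rightarrow> complex mat" and \<epsilon> :: real
    assume n: "1 \<le> n" and M: "1 \<le> M" and \<epsilon>: "0 < \<epsilon>"
      and Ob: "\<forall>i<M. observable n (Ob i) \<and> sum_of_few_body n k d (Ob i)"
    define B where "B = (MAX i\<in>{..<M}. spectral_norm (Ob i))"
    define L where "L = max 1 (ln (real (min M n)))"
    \<comment> \<open>If \<open>B\<close> is nonzero, this is the number of runs at which the
      Hoeffding exponent equals \<open>c * L\<close>.\<close>
    define X where "X = 2 * c * L * (3 ^ k * (K * B))\<^sup>2 / \<epsilon>\<^sup>2"
    have low: "card (dom P) \<le> k" if "i < M" "P \<in> strings n" "real_coeff n (Ob i) P \<noteq> 0" for i P
      using that Ob sum_of_few_body_pauli_coeff(1)[of n k d "Ob i" P] by (simp add: real_coeff_eq_0_iff)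
    have coeff: "(\<Sum>P\<in>strings n. \<bar>real_coeff n (Ob i) P\<bar>) \<le> K * B" if "i < M" for i
    proof -
      have "(\<Sum>P\<in>strings n. \<bar>real_coeff n (Ob i) P\<bar>) \<le> K * spectral_norm (Ob i)"
        unfolding K_def using Ob that by (intro sum_abs_real_coeff_le_spectral_norm) auto
      also have "\<dots> \<le> K * B"
        unfolding B_def using that \<open>0 < K\<close> by (intro mult_left_mono Max_ge) auto
      finally show ?thesis .
    qed
    have bound: "4 * c * (3 ^ k * K)\<^sup>2 * (L * B\<^sup>2 / \<epsilon>\<^sup>2) = 2 * X"
      by (simp add: X_def power_mult_distrib)
    have "1 \<le> L"
      by (simp add: L_def)
    have "0 \<le> X"
      using \<open>1 \<le> c\<close> \<open>1 \<le> L\<close> by (simp add: X_def)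
    let ?good = "\<lambda>N. \<exists>est :: (nat \<Rightarrow> (nat \<Rightarrow> pauli) \<times> (nat \<Rightarrow> bool)) \<Rightarrow> nat \<Rightarrow> real.
      \<forall>\<rho>. quantum_state n \<rho> \<longrightarrow> measure_pmf.prob (randomized_pauli_measurements N n \<rho>)
        {\<omega>. \<forall>i<M. cmod (complex_of_real (est \<omega> i) - mat_trace (Ob i * \<rho>)) \<le> \<epsilon>} \<ge> 1 - \<delta>"
    have "\<exists>N\<^sub>0::nat. real N\<^sub>0 \<le> 2 * X \<and> (\<forall>N\<ge>N\<^sub>0. ?good N)"
    \<comment> \<open>In the first case every trace has modulus at most \<open>\<epsilon>\<close>,
      so the estimate 0 works with no runs. In the second \<open>1 \<le> X\<close>, so rounding up
      at most doubles \<open>X\<close>; for small \<open>X\<close> it could do worse.\<close>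
    proof (cases "3 ^ k * (K * B) \<le> \<epsilon>")
      case True
      have "?good N" for N
      proof (intro exI[of _ "\<lambda>_ _. 0"] allI impI)
        fix \<rho> assume \<rho>: "quantum_state n \<rho>"
        have "cmod (mat_trace (Ob i * \<rho>)) \<le> \<epsilon>" if "i < M" for i
        proof -
          have "cmod (mat_trace (Ob i * \<rho>)) \<le> 3 ^ k * (\<Sum>P\<in>strings n. \<bar>real_coeff n (Ob i) P\<bar>)"
            using Ob that by (intro cmod_trace_mult_le_sum_coeff \<rho> low[OF that]) auto
          also have "\<dots> \<le> 3 ^ k * (K * B)"
            using coeff[OF that] by simp
          finally show ?thesis
            using True by simp
        qed
        then show "measure_pmf.prob (randomized_pauli_measurements N n \<rho>)
            {\<omega>. \<forall>i<M. cmod (complex_of_real 0 - mat_trace (Ob i * \<rho>)) \<le> \<epsilon>} \<ge> 1 - \<delta>"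
          using assms by simp
      qed
      then show ?thesis
        using \<open>0 \<le> X\<close> by (intro exI[of _ 0]) auto
    next
      case False
      then have KB: "0 < K * B"
        using \<epsilon> by (smt (verit) mult_nonneg_nonpos zero_le_power)
      have "1 \<le> (3 ^ k * (K * B))\<^sup>2 / \<epsilon>\<^sup>2"
        using False \<epsilon> by (simp add: power_mono)
      moreover have "1 \<le> c * L"
        using mult_mono[OF \<open>1 \<le> c\<close> \<open>1 \<le> L\<close>] \<open>1 \<le> c\<close> by simp
      ultimately have "1 * 1 \<le> (c * L) * ((3 ^ k * (K * B))\<^sup>2 / \<epsilon>\<^sup>2)"
        by (intro mult_mono) auto
      then have "1 \<le> X"
        by (simp add: X_def mult.assoc)
      show ?thesis
      proof (intro exI[of _ "nat \<lceil>X\<rceil>"] conjI allI impI)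
        show "real (nat \<lceil>X\<rceil>) \<le> 2 * X"
          using \<open>1 \<le> X\<close> by linarith
        fix N assume "nat \<lceil>X\<rceil> \<le> N"
        then have N: "X \<le> real N"
          by linarith
        with \<open>1 \<le> X\<close> have "0 < N"
          by (cases N) auto
        have "ln (2 / \<delta>) * 1 + (4 * real k + 1) * L \<le> c * L"
          unfolding c_def distrib_right using \<open>1 \<le> L\<close> \<open>0 < ln (2 / \<delta>)\<close>
          by (intro add_mono mult_left_mono) auto
        also have "\<dots> = X * \<epsilon>\<^sup>2 / (2 * (3 ^ k * (K * B))\<^sup>2)"
          using KB \<epsilon> by (auto simp: X_def)
        also have "\<dots> \<le> real N * \<epsilon>\<^sup>2 / (2 * (3 ^ k * (K * B))\<^sup>2)"
          using N by (intro divide_right_mono mult_right_mono) auto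
        finally have N': "ln (2 / \<delta>) + (4 * real k + 1) * L \<le> real N * \<epsilon>\<^sup>2 / (2 * (3 ^ k * (K * B))\<^sup>2)"
          by simp
        show "?good N"
          using Ob
          by (intro exI[of _ "\<lambda>\<omega> i. \<Sum>P\<in>strings n.
                real_coeff n (Ob i) P * sample_mean N (string_estimator n P) \<omega>"] allI impI
              observable_estimation[where k = k and Z = "K * B"] n M \<epsilon> \<open>0 < N\<close> assms(1)
              low coeff KB N'[unfolded L_def]) auto
      qed
    qed
    then show "\<exists>N\<^sub>0::nat. real N\<^sub>0 \<le> 4 * c * (3 ^ k * K)\<^sup>2 *
        (max 1 (ln (real (min M n))) * (MAX i\<in>{..<M}. spectral_norm (Ob i))\<^sup>2 / \<epsilon>\<^sup>2) \<and> (\<forall>N\<ge>N\<^sub>0. ?good N)"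
      unfolding B_def[symmetric] L_def[symmetric] bound .
  qed
qed

end
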